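(* Let $\nu>0$. Then for every integer $n\ge1$, $$\sum_{k \ge 1} \frac{\big[(j_k^{\nu})'\big]^2}{ \Big[ \big[(j_k^{\nu})'\big]^2- \nu^2 \Big] \Big[ \big(j_n^{\nu}\big)^2 - \big[(j_k^{\nu})'\big]^2 \Big]^2} = \frac{1}{4\big(j_n^{\nu}\big)^2}.$$
   Context: $\{j_n^{\nu}: n\ge1\}$ denotes the sequence of strictly positive zeros, in ascending order, of the Bessel function of the first kind $J_\nu$. $\{(j_n^{\nu})': n\ge1\}$ denotes the sequence of strictly positive zeros, in ascending order, of the derivative $J_\nu'$; the prime in $(j_n^\nu)'$ is only notation. *)

theory Defs
  imports "HOL-Analysis.Analysis"
begin

text \<open>Bessel function of the first kind on the positive real axis (principal branch of the power).\<close>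

definition bessel_J :: "real \<Rightarrow> real \<Rightarrow> real" where
  "bessel_J \<nu> x =
     (\<Sum>m. (-1) ^ m / (fact m * Gamma (real m + \<nu> + 1)) * (x / 2) powr (2 * real m + \<nu>))"

text \<open>The \<open>n\<close>-th strictly positive zero of \<open>f\<close> in ascending order, counted from \<open>n = 1\<close>: the positive
  zero up to which (inclusive) there are exactly \<open>n\<close> positive zeros. For \<open>n \<ge> 1\<close> the cardinality
  condition forces the set to be finite, as infinite sets have \<open>card\<close> zero. The lemma below relates
  this to increasing enumerations.\<close>

definition nth_pos_zero :: "(real \<Rightarrow> real) \<Rightarrow> nat \<Rightarrow> real" where
  "nth_pos_zero f n = (THE x. x > 0 \<and> f x = 0 \<and> card {y. 0 < y \<and> y \<le> x \<and> f y = 0} = n)"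

lemma nth_pos_zero_eq_enumeration:
  assumes mono: "strict_mono_on {1..} z"
    and zeros: "z ` {1..} = {x. x > 0 \<and> f x = 0}"
    and n: "n \<ge> 1"
  shows "nth_pos_zero f n = z n"
proof -
  have less_iff: "z i \<le> z k \<longleftrightarrow> i \<le> k" if "i \<ge> 1" "k \<ge> 1" for i k
    using strict_mono_on_less_eq[OF mono] that by auto
  have inj: "inj_on z {1..}"
    using mono by (rule strict_mono_on_imp_inj_on)
  have card_z: "card {y. 0 < y \<and> y \<le> z k \<and> f y = 0} = k" if k: "k \<ge> 1" for k
  proof -
    have "{y. 0 < y \<and> y \<le> z k \<and> f y = 0} = {y \<in> z ` {1..}. y \<le> z k}"
      unfolding zeros by auto
    also have "\<dots> = z ` {1..k}"
      using less_iff k by auto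
    finally show ?thesis
      using card_image[OF inj_on_subset[OF inj, of "{1..k}"]] by auto
  qed
  show ?thesis
    unfolding nth_pos_zero_def
  proof (rule the_equality)
    show "z n > 0 \<and> f (z n) = 0 \<and> card {y. 0 < y \<and> y \<le> z n \<and> f y = 0} = n"
      using zeros n card_z[OF n] by auto
  next
    fix x assume x: "x > 0 \<and> f x = 0 \<and> card {y. 0 < y \<and> y \<le> x \<and> f y = 0} = n"
    then have "x \<in> z ` {1..}"
      unfolding zeros by simp
    then obtain k where "k \<ge> 1" "x = z k"
      by auto
    then show "x = z n"
      using card_z x by metis
  qed
qed

definition bessel_zero :: "real \<Rightarrow> nat \<Rightarrow> real" where
  "bessel_zero \<nu> n = nth_pos_zero (bessel_J \<nu>) n"

definition bessel_deriv_zero :: "real \<Rightarrow> nat \<Rightarrow> real" where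
  "bessel_deriv_zero \<nu> n = nth_pos_zero (deriv (bessel_J \<nu>)) n"

end

theory Submission
  imports Defs "HOL-Complex_Analysis.Complex_Analysis"
begin

text \<open>
  In the variable \<open>z = x\<^sup>2\<close> the Bessel function and \<open>x\<close> times its derivative are \<open>(x / 2) powr \<nu>\<close> times entire
  functions \<open>g\<close> and \<open>f\<close> with \<open>f = \<nu> g + 2 z g'\<close>, and Bessel's equation reads
  \<open>\<nu> f + 2 z f' = (\<nu>\<^sup>2 - z) g\<close>. The squares \<open>t\<^sub>k\<close> of the zeros of the derivative are the zeros of \<open>f\<close>.

  The growth of \<open>f\<close> is of order \<open>1 / 2\<close>, in particular of exponential type zero, so its logarithmic derivative is the sum of the simple fractions
  \<open>1 / (z - t\<^sub>k)\<close>, and this may be differentiated termwise (\<open>log_deriv_limits\<close>). The summand in the theorem,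
  with \<open>a\<close> the square of a zero of the Bessel function, is a combination of \<open>1 / (\<nu>\<^sup>2 - t\<^sub>k)\<close>,
  \<open>1 / (a - t\<^sub>k)\<close> and \<open>1 / (a - t\<^sub>k)\<^sup>2\<close>. Its sum is therefore a combination of \<open>f' / f\<close> at \<open>\<nu>\<^sup>2\<close> and at \<open>a\<close> and of
  \<open>(f' / f)'\<close> at \<open>a\<close>, and the differential equation gives these three values in closed form, because \<open>g a = 0\<close>
  (\<open>log_deriv_at_g_zero\<close>, \<open>sum_over_zeros_at_g_zero\<close>).

  For this the complex zeros of \<open>f\<close> have to be exactly the \<open>t\<^sub>k\<close>, each simple and different from \<open>\<nu>\<^sup>2\<close> and from \<open>a\<close>.
  This comes from Sturm-Liouville theory in differential form: on the segment from \<open>0\<close> to a zero,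
  \<open>Q * cnj P\<close> and an energy expression are monotone (\<open>zero_imp_real_gt\<close>, \<open>no_common_zero\<close>). That there are
  infinitely many zeros, so that both sequences in the theorem are defined, follows from the product
  expansion of \<open>f\<close> (\<open>infinite_zeros\<close>) and Rolle's theorem (\<open>g_zeros_enumeration\<close>).
\<close>

section \<open>Partial fractions of the logarithmic derivative of an entire function\<close>

text \<open>Also known as growth of order at most one and minimal type. An exponent \<open>o(norm z)\<close> is what makes
  the derivatives of the logarithm that is left after removing the zeros vanish in the limit.\<close>

definition minimal_exp_type :: "(complex \<Rightarrow> complex) \<Rightarrow> bool" where
  "minimal_exp_type f \<longleftrightarrow> (\<forall>\<epsilon>>0. \<exists>C. \<forall>z. norm (f z) \<le> C * exp (\<epsilon> * norm z))"

text \<open>Borel-Caratheodory: \<open>h / (2 A - h)\<close> maps the half plane \<open>Re h < A\<close> into the unit disc, so Schwarz'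
  lemma turns a one-sided bound on the real part into a bound on the modulus.\<close>

lemma borel_caratheodory:
  assumes holh: "h holomorphic_on ball 0 R" and h0: "h 0 = 0" and A: "A > 0"
    and Re_h: "\<And>z. z \<in> ball 0 R \<Longrightarrow> Re (h z) < A"
    and z: "norm z < R"
  shows "norm (h z) \<le> 2 * A * norm z / (R - norm z)"
proof -
  have R: "R > 0"
    using z norm_ge_zero[of z] by linarith
  define \<phi> where "\<phi> w = h (R * w) / (2 * A - h (R * w))" for w :: complex
  have ball: "R * w \<in> ball 0 R" if "norm w < 1" for w :: complex
    using that R by (simp add: norm_mult)
  have lt: "norm (h u) < norm (2 * A - h u)" if "u \<in> ball 0 R" for u
  proof -
    have "(norm (2 * A - h u))\<^sup>2 - (norm (h u))\<^sup>2 = 4 * A * (A - Re (h u))"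
      unfolding cmod_power2 by (simp add: power2_eq_square algebra_simps)
    moreover have "4 * A * (A - Re (h u)) > 0"
      using A Re_h[OF that] by simp
    ultimately have "(norm (h u))\<^sup>2 < (norm (2 * A - h u))\<^sup>2"
      by linarith
    thus ?thesis
      by (rule power_less_imp_less_base) simp
  qed
  have nz: "2 * A - h u \<noteq> 0" if "u \<in> ball 0 R" for u
    using lt[OF that] norm_ge_zero[of "h u"] by (metis norm_zero not_less)
  have hol\<phi>: "\<phi> holomorphic_on ball 0 1"
  proof -
    have "(h \<circ> (\<lambda>w. R * w)) holomorphic_on ball 0 1"
      by (rule holomorphic_on_compose_gen[OF _ holh]) (use ball in \<open>auto intro!: holomorphic_intros\<close>)
    hence "(\<lambda>w. h (R * w)) holomorphic_on ball 0 1"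
      by (simp add: o_def)
    thus ?thesis
      unfolding \<phi>_def by (intro holomorphic_intros) (use nz ball in auto)
  qed
  have \<phi>_lt: "norm (\<phi> w) < 1" if "norm w < 1" for w
    using lt[OF ball[OF that]] nz[OF ball[OF that]]
    by (auto simp: \<phi>_def norm_divide divide_simps)
  define w where "w = z / R"
  have nw: "norm w = norm z / R"
    using R by (simp add: w_def norm_divide)
  have w1: "norm w < 1"
    using z R by (simp add: nw)
  have \<phi>w: "norm (\<phi> w) \<le> norm w"
    by (rule Schwarz_Lemma(1)[OF hol\<phi> _ \<phi>_lt w1]) (auto simp: \<phi>_def h0)
  have Rw: "R * w = z"
    using R by (simp add: w_def)
  have nzz: "2 * A - h z \<noteq> 0"
    using nz z by simp
  have "h z = \<phi> w * (2 * A - h z)"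
    using nzz by (simp add: \<phi>_def Rw)
  hence "norm (h z) = norm (\<phi> w) * norm (2 * A - h z)"
    by (metis norm_mult)
  also have "\<dots> \<le> norm w * (2 * A + norm (h z))"
    using \<phi>w A norm_triangle_ineq4[of "2 * A" "h z"] by (intro mult_mono) (auto simp: norm_mult)
  finally have "norm (h z) * (1 - norm w) \<le> 2 * A * norm w"
    by (simp add: algebra_simps)
  hence "norm (h z) * (1 - norm w) * R \<le> 2 * A * norm w * R"
    using R by (intro mult_right_mono) auto
  moreover have "(1 - norm w) * R = R - norm z" "norm w * R = norm z"
    using R by (simp_all add: nw field_simps)
  ultimately have "norm (h z) * (R - norm z) \<le> 2 * A * norm z"
    by (metis mult.assoc)
  thus ?thesis
    using z by (simp add: pos_le_divide_eq)
qed

text \<open>The quotient is again entire, and it is non-zero at the removed points because the zeros were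
  simple.\<close>

lemma divide_out_simple_zeros:
  assumes "finite W" and holf: "f holomorphic_on UNIV"
    and "\<And>w. w \<in> W \<Longrightarrow> f w = 0 \<and> deriv f w \<noteq> 0 \<and> w \<noteq> 0"
  shows "\<exists>g. g holomorphic_on UNIV \<and> (\<forall>z. f z = g z * (\<Prod>w\<in>W. 1 - z / w)) \<and> (\<forall>w\<in>W. g w \<noteq> 0)"
  using assms(1,3)
proof (induction W rule: finite_induct)
  case empty
  thus ?case using holf by auto
next
  case (insert a W)
  then obtain g where holg: "g holomorphic_on UNIV"
    and fg: "\<And>z. f z = g z * (\<Prod>w\<in>W. 1 - z / w)" and gW: "\<And>w. w \<in> W \<Longrightarrow> g w \<noteq> 0"
    by fastforce
  have a: "f a = 0" "deriv f a \<noteq> 0" "a \<noteq> 0"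
    using insert.prems by auto
  have Pa: "(\<Prod>w\<in>W. 1 - a / w) \<noteq> 0"
    using insert by (auto simp: divide_simps)
  have ga: "g a = 0"
    using fg[of a] a Pa by simp
  have "((\<lambda>z. g z * (\<Prod>w\<in>W. 1 - z / w)) has_field_derivative
          deriv g a * (\<Prod>w\<in>W. 1 - a / w)) (at a)"
  proof -
    have 1: "(g has_field_derivative deriv g a) (at a)"
      using holg by (simp add: holomorphic_derivI)
    have "(\<lambda>z. \<Prod>w\<in>W. 1 - z / w) holomorphic_on UNIV"
      using insert.prems by (intro holomorphic_intros) auto
    hence 2: "((\<lambda>z. \<Prod>w\<in>W. 1 - z / w) has_field_derivative deriv (\<lambda>z. \<Prod>w\<in>W. 1 - z / w) a) (at a)"
      by (simp add: holomorphic_derivI)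
    show ?thesis
      using DERIV_mult[OF 1 2] ga by simp
  qed
  hence "deriv f a = deriv g a * (\<Prod>w\<in>W. 1 - a / w)"
    by (intro DERIV_imp_deriv) (simp add: fg[abs_def])
  hence dga: "deriv g a \<noteq> 0"
    using a by auto
  \<comment> \<open>\<open>q\<close> is \<open>g z / (1 - z / a)\<close> with its removable singularity at \<open>a\<close> filled in.\<close>
  define q where "q z = - a * (if z = a then deriv g a else (g z - g a) / (z - a))" for z
  have "q holomorphic_on UNIV"
    unfolding q_def by (intro holomorphic_intros pole_lemma_open[OF holg]) auto
  moreover have gq: "g z = q z * (1 - z / a)" for z
    using a by (cases "z = a") (auto simp: q_def ga field_simps)
  moreover have "q a \<noteq> 0"
    using dga a by (simp add: q_def)
  moreover have "q w \<noteq> 0" if "w \<in> W" for w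
    using gW[OF that] gq[of w] by auto
  moreover have "f z = q z * (\<Prod>w\<in>insert a W. 1 - z / w)" for z
    using insert.hyps by (simp add: fg gq mult.assoc)
  ultimately show ?case
    by (intro exI[of _ q]) auto
qed

locale simple_zeros_minimal_type =
  fixes f :: "complex \<Rightarrow> complex"
  assumes holf: "f holomorphic_on UNIV"
    and type: "minimal_exp_type f"
    and f0: "f 0 \<noteq> 0"
    and simple: "\<And>w. f w = 0 \<Longrightarrow> deriv f w \<noteq> 0"
begin

definition zeros_upto :: "real \<Rightarrow> complex set" where
  "zeros_upto R = {w. f w = 0 \<and> norm w \<le> R}"

lemma finite_zeros_upto: "finite (zeros_upto R)"
proof -
  have "\<not> f constant_on UNIV" if "f w = 0" for w
    using f0 that unfolding constant_on_def by (metis UNIV_I)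
  hence "finite {w \<in> cball 0 R. f w = 0}" if "f w = 0" for w
    using that holomorphic_compact_finite_zeros[OF holf, of "cball 0 R"] by auto
  hence "finite (zeros_upto R)" if "f w = 0" for w
    using that by (auto simp: zeros_upto_def conj_commute)
  moreover have "zeros_upto R = {}" if "\<And>w. f w \<noteq> 0"
    using that by (auto simp: zeros_upto_def)
  ultimately show ?thesis
    by (metis finite.emptyI)
qed

text \<open>Divide \<open>f\<close> by the product over its zeros of modulus at most \<open>R\<close>. On the circle of radius \<open>2 R\<close> every
  factor \<open>1 - z / w\<close> has modulus at least one, so by the maximum principle the quotient inherits the
  growth bound of \<open>f\<close> throughout the disc. Inside the disc of radius \<open>R\<close> it has no zeros, hence a
  logarithm \<open>h\<close>, and Borel-Caratheodory bounds \<open>h z\<close> by \<open>\<epsilon> * norm z\<close>.\<close>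

lemma log_remainder:
  assumes "\<epsilon> > 0"
  shows "\<forall>\<^sub>F R in at_top. \<exists>h. h holomorphic_on ball 0 R \<and>
           (\<forall>z. norm z \<le> R / 2 \<longrightarrow> norm (h z) \<le> \<epsilon> * norm z) \<and>
           (\<forall>z \<in> ball 0 R. f z = f 0 * exp (h z) * (\<Prod>w\<in>zeros_upto R. 1 - z / w))"
proof -
  \<comment> \<open>The real part of the logarithm will be below \<open>3 * \<delta> * R\<close>, and for \<open>norm z \<le> R / 2\<close> Borel-Caratheodory then
      gives \<open>2 * (3 * \<delta> * R) * norm z / (R / 2)\<close>.\<close>
  define \<delta> where "\<delta> = \<epsilon> / 12"
  have \<delta>: "\<delta> > 0" using assms by (simp add: \<delta>_def)
  obtain C where C: "\<And>z. norm (f z) \<le> C * exp (\<delta> * norm z)"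
    using type \<delta> unfolding minimal_exp_type_def by blast
  have C0: "C > 0"
  proof -
    have "0 < norm (f 0)" using f0 by simp
    also have "\<dots> \<le> C" using C[of 0] by simp
    finally show ?thesis .
  qed
  show ?thesis
    using eventually_gt_at_top[of 0] eventually_gt_at_top[of "ln (C / norm (f 0)) / \<delta>"]
  proof eventually_elim
    case (elim R)
    note R = \<open>0 < R\<close>
    have lnR: "ln (C / norm (f 0)) < \<delta> * R"
      using elim(2) \<delta> by (simp add: field_simps)
    let ?W = "zeros_upto R"
    have W: "f w = 0 \<and> deriv f w \<noteq> 0 \<and> w \<noteq> 0" if "w \<in> ?W" for w
      using that simple f0 by (auto simp: zeros_upto_def)
    obtain g where holg: "g holomorphic_on UNIV"
      and fg: "\<And>z. f z = g z * (\<Prod>w\<in>?W. 1 - z / w)" and gW: "\<And>w. w \<in> ?W \<Longrightarrow> g w \<noteq> 0"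
      using divide_out_simple_zeros[OF finite_zeros_upto holf W] by blast
    have g0: "g 0 = f 0"
      using fg[of 0] by simp
    have g_nz: "g z \<noteq> 0" if "z \<in> ball 0 R" for z
    proof
      assume gz: "g z = 0"
      hence "f z = 0" by (simp add: fg)
      hence "z \<in> ?W" using that by (simp add: zeros_upto_def)
      thus False using gW gz by blast
    qed
    have bnd_sphere: "norm (g z) \<le> C * exp (\<delta> * (2 * R))" if "norm z = 2 * R" for z
    proof -
      have "1 \<le> norm (1 - z / w)" if "w \<in> ?W" for w
      proof -
        have "norm w \<le> R" "w \<noteq> 0"
          using that W[OF that] by (simp_all add: zeros_upto_def)
        hence "norm (z / w) \<ge> 2"
          using \<open>norm z = 2 * R\<close> by (simp add: norm_divide field_simps)
        thus ?thesis
          using norm_triangle_ineq2[of "z / w" 1] by (simp add: norm_minus_commute)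
      qed
      hence "1 \<le> norm (\<Prod>w\<in>?W. 1 - z / w)"
        unfolding prod_norm[symmetric] by (intro prod_ge_1) auto
      hence "norm (g z) \<le> norm (f z)"
        unfolding fg[of z] norm_mult using mult_left_mono[of 1 _ "norm (g z)"] by simp
      thus ?thesis
        using C[of z] that by simp
    qed
    have bnd: "norm (g z) \<le> C * exp (\<delta> * (2 * R))" if "norm z < R" for z
    proof (rule maximum_modulus_frontier[of g "ball 0 (2 * R)"])
      show "norm (g u) \<le> C * exp (\<delta> * (2 * R))" if "u \<in> frontier (ball 0 (2 * R))" for u
        using that R bnd_sphere by (auto simp: frontier_ball)
    qed (use holg R that in \<open>auto intro: holomorphic_on_imp_continuous_on holomorphic_on_subset\<close>)
    obtain H where holH: "H holomorphic_on ball 0 R" and H: "\<And>z. z \<in> ball 0 R \<Longrightarrow> exp (H z) = g z"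
      by (rule holomorphic_logarithm_exists[of "ball 0 R" g 0])
         (use R g_nz holg in \<open>auto intro: holomorphic_on_subset\<close>)
    define h where "h z = H z - H 0" for z
    have holh: "h holomorphic_on ball 0 R"
      unfolding h_def by (intro holomorphic_intros holH)
    have exph: "g z = f 0 * exp (h z)" if "z \<in> ball 0 R" for z
      using H[OF that] H[of 0] R g0 g_nz[of 0] by (simp add: h_def exp_diff)
    have Re_h: "Re (h z) < 3 * \<delta> * R" if z: "z \<in> ball 0 R" for z
    proof -
      have "norm (f 0) * exp (Re (h z)) \<le> C * exp (\<delta> * (2 * R))"
        using bnd[of z] z exph[OF z] by (simp add: norm_mult)
      hence "exp (Re (h z)) \<le> C / norm (f 0) * exp (\<delta> * (2 * R))"
        using f0 by (simp add: field_simps)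
      also have "\<dots> = exp (ln (C / norm (f 0)) + \<delta> * (2 * R))"
        using C0 f0 by (simp add: exp_add)
      finally have "Re (h z) \<le> ln (C / norm (f 0)) + \<delta> * (2 * R)"
        by simp
      thus ?thesis using lnR by (simp add: algebra_simps)
    qed
    have "norm (h z) \<le> \<epsilon> * norm z" if z: "norm z \<le> R / 2" for z
    proof -
      have zR: "norm z < R" using z R by simp
      have "norm (h z) \<le> 2 * (3 * \<delta> * R) * norm z / (R - norm z)"
        by (rule borel_caratheodory[OF holh _ _ Re_h zR]) (use \<delta> R in \<open>auto simp: h_def\<close>)
      also have "\<dots> \<le> 2 * (3 * \<delta> * R) * norm z / (R / 2)"
        using z zR R \<delta> by (intro divide_left_mono) (auto intro!: mult_nonneg_nonneg mult_pos_pos)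
      also have "\<dots> = \<epsilon> * norm z" 
        using R by (simp add: \<delta>_def)
      finally show ?thesis .
    qed
    moreover have "\<forall>z \<in> ball 0 R. f z = f 0 * exp (h z) * (\<Prod>w\<in>?W. 1 - z / w)"
      using fg exph by metis
    ultimately show ?case
      using holh by blast
  qed
qed

lemma log_deriv_remainder:
  assumes h: "h holomorphic_on ball 0 R"
    and f_eq: "\<And>z. z \<in> ball 0 R \<Longrightarrow> f z = f 0 * exp (h z) * (\<Prod>w\<in>zeros_upto R. 1 - z / w)"
    and z: "z \<in> ball 0 R" "f z \<noteq> 0"
  shows "deriv h z = deriv f z / f z - (\<Sum>w\<in>zeros_upto R. 1 / (z - w))"
    and "deriv (deriv h) z = deriv (\<lambda>z. deriv f z / f z) z + (\<Sum>w\<in>zeros_upto R. 1 / (z - w)\<^sup>2)"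
proof -
  let ?W = "zeros_upto R"
  have main: "deriv h u = deriv f u / f u - (\<Sum>w\<in>?W. 1 / (u - w))"
    if u: "u \<in> ball 0 R" "f u \<noteq> 0" for u
  proof -
    have W: "w \<noteq> 0" "u \<noteq> w" if "w \<in> ?W" for w
      using that f0 u by (auto simp: zeros_upto_def)
    have 1: "((\<lambda>z. \<Prod>w\<in>?W. 1 - z / w) has_field_derivative
            (\<Prod>w\<in>?W. 1 - u / w) * (\<Sum>w\<in>?W. (- 1 / w) / (1 - u / w))) (at u)"
      by (rule has_field_derivative_prod') (use W in \<open>auto intro!: derivative_eq_intros simp: field_simps\<close>)
    have 2: "(h has_field_derivative deriv h u) (at u)"
      using h u by (simp add: holomorphic_derivI)
    have "((\<lambda>z. f 0 * exp (h z) * (\<Prod>w\<in>?W. 1 - z / w)) has_field_derivative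
             f 0 * exp (h u) * (\<Prod>w\<in>?W. 1 - u / w) * (deriv h u + (\<Sum>w\<in>?W. (- 1 / w) / (1 - u / w)))) (at u)"
      using 1 2 by (auto intro!: derivative_eq_intros simp: algebra_simps)
    hence "(f has_field_derivative f u * (deriv h u + (\<Sum>w\<in>?W. (- 1 / w) / (1 - u / w)))) (at u)"
      unfolding f_eq[OF u(1), symmetric]
      by (rule DERIV_cong_ev[THEN iffD2, rotated -1, OF _ refl _ refl])
         (use u f_eq in \<open>auto intro!: eventually_mono[OF eventually_nhds_in_open[of "ball 0 R"]]\<close>)
    hence "deriv f u = f u * (deriv h u + (\<Sum>w\<in>?W. (- 1 / w) / (1 - u / w)))"
      by (rule DERIV_imp_deriv)
    moreover have "(\<Sum>w\<in>?W. (- 1 / w) / (1 - u / w)) = (\<Sum>w\<in>?W. 1 / (u - w))"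
    proof (intro sum.cong refl)
      fix w assume "w \<in> ?W"
      hence "w \<noteq> 0" "u - w \<noteq> 0" "w - u \<noteq> 0" using W by auto
      thus "(- 1 / w) / (1 - u / w) = 1 / (u - w)"
        by (simp add: divide_simps)
    qed
    ultimately show ?thesis
      using u by simp
  qed
  show "deriv h z = deriv f z / f z - (\<Sum>w\<in>?W. 1 / (z - w))"
    using main z by blast
  define S where "S = {u \<in> ball 0 R. f u \<noteq> 0}"
  have "open S"
  proof -
    have "S = ball 0 R \<inter> f -` (- {0})" by (auto simp: S_def)
    thus ?thesis
      using continuous_open_vimage[of "- {0}" f] holomorphic_on_imp_continuous_on[OF holf]
      by (auto simp: continuous_on_eq_continuous_at intro!: open_Int)
  qed
  have zS: "z \<in> S" using z by (simp add: S_def)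
  have holL: "(\<lambda>z. deriv f z / f z) holomorphic_on S"
  proof -
    have "f holomorphic_on S"
      using holf by (rule holomorphic_on_subset) simp
    thus ?thesis
      using \<open>open S\<close> by (intro holomorphic_on_divide holomorphic_deriv) (auto simp: S_def)
  qed
  have "((\<lambda>u. deriv f u / f u - (\<Sum>w\<in>?W. 1 / (u - w))) has_field_derivative
           deriv (\<lambda>z. deriv f z / f z) z - (\<Sum>w\<in>?W. - 1 / (z - w)\<^sup>2)) (at z)"
    using holomorphic_derivI[OF holL \<open>open S\<close> zS] z
    by (intro derivative_intros)
       (auto intro!: derivative_eq_intros simp: zeros_upto_def power2_eq_square)
  hence "(deriv h has_field_derivative
           deriv (\<lambda>z. deriv f z / f z) z - (\<Sum>w\<in>?W. - 1 / (z - w)\<^sup>2)) (at z)"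
    by (rule DERIV_cong_ev[THEN iffD2, rotated -1, OF _ refl _ refl])
       (use zS main in \<open>auto intro!: eventually_mono[OF eventually_nhds_in_open[OF \<open>open S\<close>]] simp: S_def\<close>)
  thus "deriv (deriv h) z = deriv (\<lambda>z. deriv f z / f z) z + (\<Sum>w\<in>?W. 1 / (z - w)\<^sup>2)"
    by (simp add: DERIV_imp_deriv sum_negf)
qed

text \<open>Cauchy's inequalities on a disc of radius \<open>R / 4\<close> send the first two derivatives of the remainder
  to zero. What is left is the partial fraction expansion of the logarithmic derivative and its
  derivative, with the zeros summed in order of modulus; in type zero these sums need not converge
  absolutely.\<close>

lemma log_deriv_limits:
  assumes z: "f z \<noteq> 0"
  shows "((\<lambda>R. \<Sum>w\<in>zeros_upto R. 1 / (z - w)) \<longlongrightarrow> deriv f z / f z) at_top" (is ?A)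
    and "((\<lambda>R. \<Sum>w\<in>zeros_upto R. 1 / (z - w)\<^sup>2) \<longlongrightarrow> - deriv (\<lambda>z. deriv f z / f z) z) at_top" (is ?B)
proof -
  have key: "\<forall>\<^sub>F R in at_top. norm ((\<Sum>w\<in>zeros_upto R. 1 / (z - w)) - deriv f z / f z) < e \<and>
       norm ((\<Sum>w\<in>zeros_upto R. 1 / (z - w)\<^sup>2) - (- deriv (\<lambda>z. deriv f z / f z) z)) < e"
    if e: "e > 0" for e
  proof -
    define \<epsilon> where "\<epsilon> = e / 64"
    have \<epsilon>: "\<epsilon> > 0" using e by (simp add: \<epsilon>_def)
    show ?thesis
      using log_remainder[OF \<epsilon>] eventually_ge_at_top[of "4 * norm z"] eventually_ge_at_top[of 1]
    proof eventually_elim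
      case (elim R)
      then obtain h where h: "h holomorphic_on ball 0 R"
        and bnd: "\<And>z. norm z \<le> R / 2 \<Longrightarrow> norm (h z) \<le> \<epsilon> * norm z"
        and f_eq: "\<And>z. z \<in> ball 0 R \<Longrightarrow> f z = f 0 * exp (h z) * (\<Prod>w\<in>zeros_upto R. 1 - z / w)"
        by blast
      have sub: "cball z (R / 4) \<subseteq> cball 0 (R / 2)"
      proof
        fix x assume "x \<in> cball z (R / 4)"
        thus "x \<in> cball 0 (R / 2)"
          using elim(2) norm_triangle_ineq2[of x z] by (simp add: dist_norm norm_minus_commute)
      qed
      have sub': "cball z (R / 4) \<subseteq> ball 0 R"
        using sub elim by fastforce
      have cauchy: "norm ((deriv ^^ k) h z) \<le> fact k * (\<epsilon> * R) / (R / 4) ^ k" for k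
      proof (rule Cauchy_inequality)
        show "h holomorphic_on ball z (R / 4)"
          using sub' ball_subset_cball by (blast intro: holomorphic_on_subset[OF h])
        show "continuous_on (cball z (R / 4)) h"
          using sub' by (blast intro: holomorphic_on_imp_continuous_on holomorphic_on_subset[OF h])
        show "norm (h x) \<le> \<epsilon> * R" if "norm (z - x) = R / 4" for x
        proof -
          have x: "norm x \<le> R / 2"
            using sub that by (auto simp: dist_norm subset_eq)
          have "norm (h x) \<le> \<epsilon> * norm x"
            by (rule bnd[OF x])
          also have "\<dots> \<le> \<epsilon> * R"
            using x elim \<epsilon> by (intro mult_left_mono) auto
          finally show ?thesis .
        qed
      qed (use elim in auto)
      have zR: "z \<in> ball 0 R"
        using elim by auto
      have rem: "deriv h z = deriv f z / f z - (\<Sum>w\<in>zeros_upto R. 1 / (z - w))"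
        "deriv (deriv h) z = deriv (\<lambda>z. deriv f z / f z) z + (\<Sum>w\<in>zeros_upto R. 1 / (z - w)\<^sup>2)"
        using f_eq by (blast intro: log_deriv_remainder[OF h _ zR z])+
      have "norm (deriv h z) \<le> 4 * \<epsilon>"
        using cauchy[of 1] elim by (simp add: field_simps)
      moreover have "norm (deriv (deriv h) z) \<le> 32 * \<epsilon>"
      proof -
        have "norm (deriv (deriv h) z) \<le> 32 * \<epsilon> / R"
          using cauchy[of 2] elim by (simp add: field_simps power2_eq_square numeral_2_eq_2)
        also have "\<dots> \<le> 32 * \<epsilon>"
          using elim \<epsilon> by (simp add: field_simps)
        finally show ?thesis .
      qed
      moreover have "norm ((\<Sum>w\<in>zeros_upto R. 1 / (z - w)) - deriv f z / f z) = norm (deriv h z)"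
        unfolding rem(1) by (rule norm_minus_commute)
      moreover have "norm ((\<Sum>w\<in>zeros_upto R. 1 / (z - w)\<^sup>2) - (- deriv (\<lambda>z. deriv f z / f z) z))
                       = norm (deriv (deriv h) z)"
        unfolding rem(2) by (simp add: add.commute)
      ultimately show ?case
        using \<epsilon> by (simp add: \<epsilon>_def)
    qed
  qed
  show ?A ?B
    unfolding tendsto_iff dist_norm
    using key by (simp_all add: eventually_conj_iff)
qed

text \<open>The same remainder estimate gives the product expansion without an exponential factor. It
  serves to show that a function with finitely many zeros is a polynomial.\<close>

lemma hadamard_product:
  "((\<lambda>R. f 0 * (\<Prod>w\<in>zeros_upto R. 1 - z / w)) \<longlongrightarrow> f z) at_top"
  (is "(?P \<longlongrightarrow> _) _")
proof (rule tendstoI)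
  fix e :: real assume e: "e > 0"
  have "((\<lambda>u. f z * exp (- u)) \<longlongrightarrow> f z * exp (- 0)) (nhds 0)"
    by (intro tendsto_intros) (auto simp: filterlim_ident)
  hence "\<forall>\<^sub>F u in nhds 0. dist (f z * exp (- u)) (f z) < e"
    using e by (simp add: tendsto_iff)
  then obtain d where d: "d > 0" "\<And>u. norm u < d \<Longrightarrow> dist (f z * exp (- u)) (f z) < e"
    by (auto simp: eventually_nhds_metric)
  define \<epsilon> where "\<epsilon> = d / (norm z + 1)"
  have \<epsilon>: "\<epsilon> > 0" "\<epsilon> * norm z < d"
    using d norm_ge_zero[of z] by (auto simp: \<epsilon>_def field_simps add_pos_nonneg)
  show "\<forall>\<^sub>F R in at_top. dist (?P R) (f z) < e"
    using log_remainder[OF \<epsilon>(1)] eventually_gt_at_top[of "2 * norm z"] eventually_gt_at_top[of 0]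
  proof eventually_elim
    case (elim R)
    then obtain h where h: "\<And>z. norm z \<le> R / 2 \<Longrightarrow> norm (h z) \<le> \<epsilon> * norm z"
      and f_eq: "\<And>z. z \<in> ball 0 R \<Longrightarrow> f z = f 0 * exp (h z) * (\<Prod>w\<in>zeros_upto R. 1 - z / w)"
      by blast
    have hz: "norm (h z) \<le> \<epsilon> * norm z" 
      using h elim by simp
    have "f z = f 0 * exp (h z) * (\<Prod>w\<in>zeros_upto R. 1 - z / w)"
      by (rule f_eq) (use elim in auto)
    hence "f z * exp (- h z) = exp (h z) * exp (- h z) * ?P R"
      by (simp only: mult_ac)
    hence "?P R = f z * exp (- h z)"
      by (simp flip: exp_add)
    thus ?case
      using d(2)[of "h z"] hz \<epsilon>(2) by simp
  qed
qed

lemma finitely_many_zeros_imp_product: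
  assumes "finite {w. f w = 0}"
  shows "f z = f 0 * (\<Prod>w | f w = 0. 1 - z / w)"
proof -
  obtain B where B: "\<And>w. f w = 0 \<Longrightarrow> norm w \<le> B"
    using finite_imp_bounded[OF assms] by (auto simp: bounded_iff)
  have "\<forall>\<^sub>F R in at_top. f 0 * (\<Prod>w\<in>zeros_upto R. 1 - z / w) = f 0 * (\<Prod>w | f w = 0. 1 - z / w)"
    using eventually_ge_at_top[of B]
  proof eventually_elim
    case (elim R)
    have "zeros_upto R = {w. f w = 0}"
      using B elim by (force simp: zeros_upto_def)
    thus ?case by simp
  qed
  hence "((\<lambda>R. f 0 * (\<Prod>w\<in>zeros_upto R. 1 - z / w)) \<longlongrightarrow> f 0 * (\<Prod>w | f w = 0. 1 - z / w)) at_top"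
    by (rule tendsto_eventually)
  thus ?thesis
    using tendsto_unique[OF _ hadamard_product] by auto
qed

end

section \<open>Entire power series\<close>

text \<open>Coefficients that are \<open>O(\<epsilon> ^ m / fact m)\<close> for every \<open>\<epsilon>\<close> are dominated by those of \<open>exp (\<epsilon> * norm z)\<close>.\<close>

lemma powser_minimal_exp_type:
  fixes a :: "nat \<Rightarrow> complex"
  assumes summable: "\<And>x. x \<ge> 0 \<Longrightarrow> summable (\<lambda>m. norm (a m) * fact m * x ^ m)"
  shows "minimal_exp_type (\<lambda>z. \<Sum>m. a m * z ^ m)"
    and "summable (\<lambda>m. a m * z ^ m)"
proof -
  have main: "summable (\<lambda>m. norm (a m * z ^ m)) \<and>
      norm (\<Sum>m. a m * z ^ m) \<le> (\<Sum>m. norm (a m) * fact m * (1 / \<epsilon>) ^ m) * exp (\<epsilon> * norm z)"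
    (is "_ \<and> _ \<le> ?C * _") if \<epsilon>: "\<epsilon> > 0" for \<epsilon> z
  proof -
    have le: "norm (a m * z ^ m) \<le> ?C * ((\<epsilon> * norm z) ^ m /\<^sub>R fact m)" for m
    proof -
      have "norm (a m) * fact m * (1 / \<epsilon>) ^ m \<le> ?C"
        using sum_le_suminf[OF summable[of "1 / \<epsilon>"], of "{m}"] \<epsilon> by simp
      hence "norm (a m) * fact m * (1 / \<epsilon>) ^ m * ((\<epsilon> * norm z) ^ m /\<^sub>R fact m)
               \<le> ?C * ((\<epsilon> * norm z) ^ m /\<^sub>R fact m)"
        using \<epsilon> by (intro mult_right_mono) auto
      also have "norm (a m) * fact m * (1 / \<epsilon>) ^ m * ((\<epsilon> * norm z) ^ m /\<^sub>R fact m)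
                       = norm (a m * z ^ m)"
        using \<epsilon> by (simp add: norm_mult norm_power field_simps)
      finally show ?thesis .
    qed
    have sums: "(\<lambda>m. ?C * ((\<epsilon> * norm z) ^ m /\<^sub>R fact m)) sums (?C * exp (\<epsilon> * norm z))"
      by (intro sums_mult exp_converges)
    have "summable (\<lambda>m. norm (a m * z ^ m))"
      by (rule summable_comparison_test'[OF sums_summable[OF sums], of 0]) (use le in auto)
    thus ?thesis
      using suminf_le[OF le _ sums_summable[OF sums]] summable_norm sums_unique[OF sums]
      by fastforce
  qed
  show "minimal_exp_type (\<lambda>z. \<Sum>m. a m * z ^ m)"
    unfolding minimal_exp_type_def using main by blast
  show "summable (\<lambda>m. a m * z ^ m)"
    using main[of 1 z] summable_norm_cancel by auto
qed

lemma powser_entire: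
  fixes a :: "nat \<Rightarrow> complex"
  assumes summable: "\<And>z. summable (\<lambda>m. a m * z ^ m)"
  shows "(\<lambda>z. \<Sum>m. a m * z ^ m) holomorphic_on UNIV"
    and "(\<lambda>m. of_nat m * a m * z ^ m) sums (z * deriv (\<lambda>z. \<Sum>m. a m * z ^ m) z)"
proof -
  have D: "((\<lambda>z. \<Sum>m. a m * z ^ m) has_field_derivative (\<Sum>m. diffs a m * z ^ m)) (at z)" for z
    by (rule termdiffs_strong_converges_everywhere) (rule summable)
  show "(\<lambda>z. \<Sum>m. a m * z ^ m) holomorphic_on UNIV"
    using D by (auto simp: holomorphic_on_open)
  have "summable (\<lambda>m. diffs a m * z ^ m)"
    by (rule termdiff_converges_all) (rule summable)
  hence "(\<lambda>m. z * (diffs a m * z ^ m)) sums (z * deriv (\<lambda>z. \<Sum>m. a m * z ^ m) z)"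
    unfolding DERIV_imp_deriv[OF D] by (intro sums_mult summable_sums)
  hence "(\<lambda>m. of_nat (Suc m) * a (Suc m) * z ^ Suc m) sums (z * deriv (\<lambda>z. \<Sum>m. a m * z ^ m) z)"
    by (simp add: diffs_def mult_ac)
  thus "(\<lambda>m. of_nat m * a m * z ^ m) sums (z * deriv (\<lambda>z. \<Sum>m. a m * z ^ m) z)"
    by (subst (asm) sums_Suc_iff) simp
qed

section \<open>Bessel functions in the squared variable\<close>

definition bessel_coeff :: "real \<Rightarrow> nat \<Rightarrow> real" where
  "bessel_coeff \<nu> m = (-1) ^ m / (4 ^ m * fact m * Gamma (real m + \<nu> + 1))"

text \<open>The entire factor of the Bessel function in the squared variable:
  \<open>bessel_J \<nu> x = (x / 2) powr \<nu> * bessel_core \<nu> (x\<^sup>2)\<close>.\<close>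

definition bessel_core :: "real \<Rightarrow> complex \<Rightarrow> complex" where
  "bessel_core \<nu> z = (\<Sum>m. of_real (bessel_coeff \<nu> m) * z ^ m)"

text \<open>The corresponding factor of \<open>x\<close> times the derivative of the Bessel function; termwise, the
  operator \<open>x d/dx\<close> multiplies \<open>x powr (2 * real m + \<nu>)\<close> by the exponent.\<close>

definition bessel_deriv_core :: "real \<Rightarrow> complex \<Rightarrow> complex" where
  "bessel_deriv_core \<nu> z = (\<Sum>m. of_real ((2 * real m + \<nu>) * bessel_coeff \<nu> m) * z ^ m)"

locale bessel =
  fixes \<nu> :: real
  assumes \<nu>: "\<nu> > 0"
begin

abbreviation "g \<equiv> bessel_core \<nu>"
abbreviation "f \<equiv> bessel_deriv_core \<nu>"
abbreviation "c \<equiv> bessel_coeff \<nu>"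

lemma coeff_Suc: "4 * (real m + 1) * (real m + 1 + \<nu>) * c (Suc m) = - c m"
proof -
  have "Gamma (real m + \<nu> + 1 + 1) = (real m + \<nu> + 1) * Gamma (real m + \<nu> + 1)"
    using \<nu> by (intro Gamma_plus1) (auto elim!: nonpos_Ints_cases)
  moreover have "Gamma (real m + \<nu> + 1) > 0"
    using \<nu> by (intro Gamma_real_pos) auto
  moreover have "real m + \<nu> + 1 > 0" using \<nu> by simp
  ultimately show ?thesis
    by (simp add: bessel_coeff_def add_ac divide_simps)
qed

lemma coeff_nonzero: "c m \<noteq> 0"
proof -
  have "Gamma (real m + \<nu> + 1) > 0"
    using \<nu> by (intro Gamma_real_pos) auto
  thus ?thesis by (simp add: bessel_coeff_def)
qed

lemma coeff_summable:
  assumes "x \<ge> 0"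
  shows "summable (\<lambda>m. norm (complex_of_real ((2 * real m + \<nu>) * c m)) * fact m * x ^ m)"
proof (rule summable_ratio_test)
  fix m assume m: "m \<ge> nat \<lceil>x\<rceil> + 1"
  hence mx: "real m \<ge> x" and m1: "real m \<ge> 1" by linarith+
  have "4 * (real m + 1) * (real m + 1 + \<nu>) * \<bar>c (Suc m)\<bar> = \<bar>c m\<bar>"
    using arg_cong[OF coeff_Suc, of abs m] \<nu> by (simp add: abs_mult)
  hence c: "\<bar>c m\<bar> = 4 * (real m + 1) * (real m + 1 + \<nu>) * \<bar>c (Suc m)\<bar>" by simp
  let ?t = "\<lambda>m. (2 * real m + \<nu>) * \<bar>c m\<bar> * fact m * x ^ m"
  have "(2 * real (Suc m) + \<nu>) * x \<le> (2 * (2 * real m + \<nu>)) * (real m + 1 + \<nu>)"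
    using mx m1 \<nu> assms by (intro mult_mono) auto
  hence "(2 * real (Suc m) + \<nu>) * x * (\<bar>c (Suc m)\<bar> * (real m + 1) * fact m * x ^ m) \<le>
        (2 * (2 * real m + \<nu>)) * (real m + 1 + \<nu>) * (\<bar>c (Suc m)\<bar> * (real m + 1) * fact m * x ^ m)"
    using assms by (intro mult_right_mono) auto
  hence "?t (Suc m) \<le> 1 / 2 * ?t m"
    unfolding c by (simp add: algebra_simps)
  thus "norm (norm (complex_of_real ((2 * real (Suc m) + \<nu>) * c (Suc m))) * fact (Suc m) * x ^ Suc m)
          \<le> 1 / 2 * norm (norm (complex_of_real ((2 * real m + \<nu>) * c m)) * fact m * x ^ m)"
    using assms \<nu> by (simp only: norm_of_real abs_mult) simp
qed simp

lemma f_summable: "summable (\<lambda>m. of_real ((2 * real m + \<nu>) * c m) * z ^ m :: complex)"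
  by (rule powser_minimal_exp_type(2)) (rule coeff_summable)

lemma g_summable: "summable (\<lambda>m. of_real (c m) * z ^ m :: complex)"
proof -
  have *: "summable (\<lambda>m. norm (of_real ((2 * real m + \<nu>) * c m) * z ^ m :: complex) / \<nu>)"
    using powser_insidea[OF f_summable[of "of_real (norm z + 1)"], of z]
    by (intro summable_divide) simp
  show ?thesis
  proof (rule summable_comparison_test'[OF *, of 0])
    fix m
    have "\<nu> * (\<bar>c m\<bar> * norm z ^ m) \<le> (2 * real m + \<nu>) * (\<bar>c m\<bar> * norm z ^ m)"
      by (intro mult_right_mono) auto
    moreover have "norm (of_real ((2 * real m + \<nu>) * c m) * z ^ m) = (2 * real m + \<nu>) * (\<bar>c m\<bar> * norm z ^ m)"
      using \<nu> by (simp only: norm_mult norm_power norm_of_real abs_mult)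
    moreover have "norm (of_real (c m) * z ^ m) = \<bar>c m\<bar> * norm z ^ m"
      by (simp add: norm_mult norm_power)
    ultimately show "norm (of_real (c m) * z ^ m) \<le> norm (of_real ((2 * real m + \<nu>) * c m) * z ^ m) / \<nu>"
      using \<nu> by (simp add: pos_le_divide_eq mult.commute)
  qed
qed

lemma f_sums: "(\<lambda>m. of_real ((2 * real m + \<nu>) * c m) * z ^ m) sums f z"
  unfolding bessel_deriv_core_def by (rule summable_sums) (rule f_summable)

lemma g_sums: "(\<lambda>m. of_real (c m) * z ^ m) sums g z"
  unfolding bessel_core_def by (rule summable_sums) (rule g_summable)

lemma holf: "f holomorphic_on UNIV"
  unfolding bessel_deriv_core_def[abs_def] by (rule powser_entire(1)) (rule f_summable)

lemma holg: "g holomorphic_on UNIV"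
  unfolding bessel_core_def[abs_def] by (rule powser_entire(1)) (rule g_summable)

lemma f_type: "minimal_exp_type f"
  unfolding bessel_deriv_core_def[abs_def] by (rule powser_minimal_exp_type(1)) (rule coeff_summable)

text \<open>Bessel's equation as a first-order system. With \<open>\<theta> = x d/dx = 2 z d/dz\<close> for \<open>z = x\<^sup>2\<close>, the factor
  \<open>x powr \<nu>\<close> turns \<open>\<theta>\<close> into \<open>\<theta> + \<nu>\<close>; the next two lemmas say \<open>(\<theta> + \<nu>) g = f\<close> and
  \<open>(\<theta> + \<nu>) f = (\<nu>\<^sup>2 - z) g\<close>.\<close>

lemma ode_g:
  fixes z :: complex
  shows "\<nu> * g z + 2 * z * deriv g z = f z"
proof -
  have "(\<lambda>m. of_nat m * of_real (c m) * z ^ m) sums (z * deriv g z)"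
    unfolding bessel_core_def[abs_def] by (rule powser_entire(2)) (rule g_summable)
  from sums_add[OF sums_mult[OF g_sums, of \<nu> z] sums_mult[OF this, of 2]]
  moreover have "\<nu> * (of_real (c m) * z ^ m) + 2 * (of_nat m * of_real (c m) * z ^ m) =
                   of_real ((2 * real m + \<nu>) * c m) * z ^ m" for m
    by (simp add: ring_distribs)
  ultimately have "(\<lambda>m. of_real ((2 * real m + \<nu>) * c m) * z ^ m) sums (\<nu> * g z + 2 * (z * deriv g z))"
    by (simp only:)
  from sums_unique2[OF this f_sums] show ?thesis
    by (simp only: mult.assoc)
qed

lemma ode_f:
  fixes z :: complex
  shows "\<nu> * f z + 2 * z * deriv f z = (\<nu>\<^sup>2 - z) * g z"
proof -
  have "(\<lambda>m. of_nat m * of_real ((2 * real m + \<nu>) * c m) * z ^ m) sums (z * deriv f z)"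
    unfolding bessel_deriv_core_def[abs_def] by (rule powser_entire(2)) (rule f_summable)
  from sums_diff[OF sums_add[OF sums_mult[OF f_sums, of \<nu> z] sums_mult[OF this, of 2]]
                    sums_mult[OF g_sums, of "of_real (\<nu>\<^sup>2)" z]]
  moreover have "\<nu> * (of_real ((2 * real m + \<nu>) * c m) * z ^ m) +
                   2 * (of_nat m * of_real ((2 * real m + \<nu>) * c m) * z ^ m) -
                   of_real (\<nu>\<^sup>2) * (of_real (c m) * z ^ m) =
                 of_real (4 * real m * (real m + \<nu>) * c m) * z ^ m" for m
    by (simp add: ring_distribs power2_eq_square)
  ultimately have 1: "(\<lambda>m. of_real (4 * real m * (real m + \<nu>) * c m) * z ^ m) sums
              (\<nu> * f z + 2 * (z * deriv f z) - of_real (\<nu>\<^sup>2) * g z)"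
    by (simp only:)
  have "(\<lambda>m. of_real (4 * real (Suc m) * (real (Suc m) + \<nu>) * c (Suc m)) * z ^ Suc m) = 
          (\<lambda>m. - z * (of_real (c m) * z ^ m))"
  proof
    fix m
    have "4 * real (Suc m) * (real (Suc m) + \<nu>) * c (Suc m) = - c m"
      using coeff_Suc[of m] by (simp add: add_ac)
    thus "of_real (4 * real (Suc m) * (real (Suc m) + \<nu>) * c (Suc m)) * z ^ Suc m =
            - z * (of_real (c m) * z ^ m)"
      by (simp only:) simp
  qed
  hence "(\<lambda>m. of_real (4 * real (Suc m) * (real (Suc m) + \<nu>) * c (Suc m)) * z ^ Suc m) sums (- z * g z)"
    using sums_mult[OF g_sums, of "- z" z] by (simp only:)
  hence "(\<lambda>m. of_real (4 * real m * (real m + \<nu>) * c m) * z ^ m) sums (- z * g z)"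
    by (subst (asm) sums_Suc_iff) simp
  from sums_unique2[OF 1 this] have "\<nu> * f z + 2 * (z * deriv f z) - of_real (\<nu>\<^sup>2) * g z = - z * g z" .
  thus ?thesis by (simp add: algebra_simps)
qed

lemma g_0: "g 0 \<noteq> 0"
  using coeff_nonzero[of 0] by (simp add: bessel_core_def powser_zero)

lemma f_0: "f 0 \<noteq> 0"
  using ode_g[of 0] g_0 \<nu> by auto

lemma Im_g: "Im (g (of_real x)) = 0" and Im_f: "Im (f (of_real x)) = 0"
proof -
  have "Im (of_real a * of_real x ^ m) = 0" for a :: real and m
    unfolding complex_is_Real_iff[symmetric] by (intro Reals_mult Reals_power Reals_of_real)
  hence "(\<lambda>m. 0) sums Im (g (of_real x))" "(\<lambda>m. 0) sums Im (f (of_real x))"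
    using sums_Im[OF g_sums, of "of_real x"] sums_Im[OF f_sums, of "of_real x"]
    by (simp_all only:)
  thus "Im (g (of_real x)) = 0" "Im (f (of_real x)) = 0"
    by (auto dest: sums_unique2[OF sums_zero])
qed

lemma bessel_J_eq:
  assumes "x > 0"
  shows "bessel_J \<nu> x = (x / 2) powr \<nu> * Re (g (of_real (x\<^sup>2)))"
proof -
  have eq: "(-1) ^ m / (fact m * Gamma (real m + \<nu> + 1)) * (x / 2) powr (2 * real m + \<nu>) =
               (x / 2) powr \<nu> * Re (of_real (c m) * of_real (x\<^sup>2) ^ m)" for m
  proof -
    have "(x / 2) powr (2 * real m + \<nu>) = (x / 2) powr real (2 * m) * (x / 2) powr \<nu>"
      by (simp add: powr_add)
    also have "(x / 2) powr real (2 * m) = (x\<^sup>2) ^ m / 4 ^ m"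
      using assms by (subst powr_realpow) (auto simp: power_mult power_divide)
    finally have "(x / 2) powr (2 * real m + \<nu>) = (x\<^sup>2) ^ m / 4 ^ m * (x / 2) powr \<nu>" .
    moreover have "Re (of_real (c m) * of_real (x\<^sup>2) ^ m) = c m * (x\<^sup>2) ^ m"
      by (simp only: Re_complex_of_real flip: of_real_mult of_real_power)
    ultimately show ?thesis
      by (simp add: bessel_coeff_def mult_ac)
  qed
  have "(\<lambda>m. (x / 2) powr \<nu> * Re (of_real (c m) * of_real (x\<^sup>2) ^ m)) sums
          ((x / 2) powr \<nu> * Re (g (of_real (x\<^sup>2))))"
    by (intro sums_mult sums_Re g_sums)
  thus ?thesis
    unfolding bessel_J_def eq by (rule sums_unique[symmetric])
qed

lemma bessel_J_has_derivative:
  assumes x: "x > 0"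
  shows "(bessel_J \<nu> has_real_derivative (x / 2) powr \<nu> / x * Re (f (of_real (x\<^sup>2)))) (at x)"
proof -
  have G: "((\<lambda>t. Re (g (of_real t))) has_real_derivative Re (deriv g (of_real t))) (at t)" for t
    unfolding has_real_derivative_iff_has_vector_derivative
    by (intro bounded_linear.has_vector_derivative[OF bounded_linear_Re] has_vector_derivative_real_field holomorphic_derivI[OF holg]) auto
  have f: "Re (f (of_real (x\<^sup>2))) = \<nu> * Re (g (of_real (x\<^sup>2))) + 2 * x\<^sup>2 * Re (deriv g (of_real (x\<^sup>2)))"
    unfolding ode_g[symmetric] by simp
  have "((\<lambda>x. (x / 2) powr \<nu> * Re (g (of_real (x\<^sup>2)))) has_real_derivative
          (\<nu> / x * (x / 2) powr \<nu>) * Re (g (of_real (x\<^sup>2))) + (x / 2) powr \<nu> * (Re (deriv g (of_real (x\<^sup>2))) * (2 * x))) (at x)"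
  proof (rule DERIV_mult'[THEN DERIV_cong])
    show "((\<lambda>x. (x / 2) powr \<nu>) has_real_derivative \<nu> / x * (x / 2) powr \<nu>) (at x)"
      using x by (auto intro!: derivative_eq_intros simp: powr_diff field_simps)
    show "((\<lambda>x. Re (g (of_real (x\<^sup>2)))) has_real_derivative Re (deriv g (of_real (x\<^sup>2))) * (2 * x)) (at x)"
      by (rule DERIV_chain2[OF G]) (auto intro!: derivative_eq_intros)
  qed simp
  hence "((\<lambda>x. (x / 2) powr \<nu> * Re (g (of_real (x\<^sup>2)))) has_real_derivative
          (x / 2) powr \<nu> / x * Re (f (of_real (x\<^sup>2)))) (at x)"
    unfolding f by (rule back_subst[of "\<lambda>d. (_ has_real_derivative d) _"]) (use x in \<open>simp add: field_simps power2_eq_square\<close>)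
  thus ?thesis
    by (rule DERIV_cong_ev[THEN iffD2, rotated -1, OF _ refl _ refl])
       (use x bessel_J_eq in \<open>auto intro!: eventually_mono[OF eventually_nhds_in_open[of "{0<..}"]]\<close>)
qed

lemma bessel_J_eq_0_iff: "x > 0 \<Longrightarrow> bessel_J \<nu> x = 0 \<longleftrightarrow> g (of_real (x\<^sup>2)) = 0"
  using Im_g[of "x\<^sup>2"] by (simp add: bessel_J_eq complex_eq_iff)

lemma deriv_bessel_J_eq_0_iff: "x > 0 \<Longrightarrow> deriv (bessel_J \<nu>) x = 0 \<longleftrightarrow> f (of_real (x\<^sup>2)) = 0"
  using Im_f[of "x\<^sup>2"] by (simp add: DERIV_imp_deriv[OF bessel_J_has_derivative] complex_eq_iff)

end

section \<open>Location of the zeros\<close>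

lemma equal_ends_imp_derivative_zero:
  fixes K D :: "real \<Rightarrow> real"
  assumes cont: "continuous_on {0..1} K" and ends: "K 0 = K 1"
    and D: "\<And>s. 0 < s \<Longrightarrow> s < 1 \<Longrightarrow> (K has_real_derivative D s) (at s)"
    and nonneg: "\<And>s. 0 < s \<Longrightarrow> s < 1 \<Longrightarrow> 0 \<le> D s"
    and s: "0 < s" "s < 1"
  shows "D s = 0"
proof -
  have const: "K s = K 0" if "0 < s" "s < 1" for s
  proof -
    have "K 0 \<le> K s"
      by (rule DERIV_nonneg_imp_increasing_open)
         (use that in \<open>auto intro!: exI D nonneg intro: continuous_on_subset[OF cont]\<close>)
    moreover have "K s \<le> K 1"
      by (rule DERIV_nonneg_imp_increasing_open)
         (use that in \<open>auto intro!: exI D nonneg intro: continuous_on_subset[OF cont]\<close>)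
    ultimately show ?thesis using ends by simp
  qed
  have "\<forall>y. \<bar>s - y\<bar> < min s (1 - s) \<longrightarrow> K s = K y"
    using const s by (auto simp: abs_less_iff)
  thus ?thesis
    using DERIV_local_const[OF D[OF s], of "min s (1 - s)"] s by auto
qed

context bessel
begin

text \<open>For complex \<open>w \<noteq> 0\<close> these are \<open>J (\<lambda> t)\<close> and \<open>t d/dt J (\<lambda> t)\<close> up to a common constant factor, where \<open>\<lambda>\<^sup>2 = w\<close> and
  \<open>s = t\<^sup>2\<close>. They live on the real interval from \<open>0\<close> to \<open>1\<close>, even though \<open>w\<close> is complex, and solve
  \<open>2 s P' = Q\<close> and \<open>2 s Q' = (\<nu>\<^sup>2 - w s) P\<close>. Both vanish at \<open>0\<close> because \<open>\<nu> > 0\<close>, and at \<open>1\<close> they equal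
  \<open>g w\<close> and \<open>f w\<close>.\<close>

definition P :: "complex \<Rightarrow> real \<Rightarrow> complex" where
  "P w s = of_real (s powr (\<nu> / 2)) * g (w * of_real s)"

definition Q :: "complex \<Rightarrow> real \<Rightarrow> complex" where
  "Q w s = of_real (s powr (\<nu> / 2)) * f (w * of_real s)"

lemma powr_times_scaled_has_derivative:
  assumes holu: "u holomorphic_on UNIV" and s: "s > 0"
  shows "((\<lambda>s. of_real (s powr (\<nu> / 2)) * u (w * of_real s)) has_vector_derivative
           of_real (s powr (\<nu> / 2)) * (of_real \<nu> * u (w * of_real s) +
             2 * (w * of_real s) * deriv u (w * of_real s)) / of_real (2 * s)) (at s)"
proof -
  have "((\<lambda>s. s powr (\<nu> / 2)) has_real_derivative \<nu> / (2 * s) * s powr (\<nu> / 2)) (at s)"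
    using s by (intro DERIV_cong[OF has_real_derivative_powr]) (simp_all add: powr_diff)
  note A = has_vector_derivative_of_real[OF this]
  have "((\<lambda>z. u (w * z)) has_field_derivative deriv u (w * of_real s) * w) (at (of_real s))"
    by (rule DERIV_chain2[OF holomorphic_derivI[OF holu]]) (auto intro!: derivative_eq_intros)
  note B = has_vector_derivative_real_field[OF this]
  show ?thesis
    by (rule has_vector_derivative_eq_rhs[OF has_vector_derivative_mult[OF A B]])
       (use s in \<open>simp add: field_simps\<close>)
qed

lemma P_has_derivative:
  assumes "s > 0"
  shows "(P w has_vector_derivative Q w s / of_real (2 * s)) (at s)"
  unfolding P_def[abs_def] Q_def ode_g[symmetric]
  using powr_times_scaled_has_derivative[OF holg assms] .

lemma Q_has_derivative:
  assumes "s > 0"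
  shows "(Q w has_vector_derivative (of_real (\<nu>\<^sup>2) - w * of_real s) * P w s / of_real (2 * s)) (at s)"
  using powr_times_scaled_has_derivative[OF holf assms, of w]
  unfolding Q_def[abs_def] P_def ode_f by (simp add: mult_ac)

lemma continuous_on_P: "continuous_on {0..1} (P w)"
  and continuous_on_Q: "continuous_on {0..1} (Q w)"
proof -
  have "continuous_on {0..1} (\<lambda>s. of_real (s powr (\<nu> / 2)) * u (w * of_real s))"
    if "u holomorphic_on UNIV" for u
    using \<nu> by (intro continuous_intros continuous_on_powr' 
                  continuous_on_compose2[OF holomorphic_on_imp_continuous_on[OF that]]) auto
  thus "continuous_on {0..1} (P w)" "continuous_on {0..1} (Q w)"
    unfolding P_def[abs_def] Q_def[abs_def] using holg holf by blast+
qed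

lemma P_0: "P w 0 = 0" and Q_0: "Q w 0 = 0"
  by (simp_all add: P_def Q_def)

lemma P_1: "P w 1 = g w" and Q_1: "Q w 1 = f w"
  by (simp_all add: P_def Q_def)

lemma P_nonzero: "\<exists>s. 0 < s \<and> s < 1 \<and> P w s \<noteq> 0"
proof (rule ccontr)
  assume "\<not> ?thesis"
  hence zero: "g (w * of_real s) = 0" if "0 < s" "s < 1" for s
    using that by (auto simp: P_def)
  have "isCont g (w * of_real 0)"
    using holg holomorphic_on_imp_continuous_on continuous_on_eq_continuous_at by blast
  hence lim: "((\<lambda>s. g (w * of_real s)) \<longlongrightarrow> g (w * of_real 0)) (at_right 0)"
    by (rule isCont_tendsto_compose) (intro tendsto_intros)
  have "\<forall>\<^sub>F s in at_right 0. g (w * of_real s) = 0"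
    by (rule eventually_at_rightI[of 0 1]) (use zero in auto)
  hence "((\<lambda>s. g (w * of_real s)) \<longlongrightarrow> 0) (at_right 0)"
    by (rule tendsto_eventually)
  from tendsto_unique[OF _ lim this] have "g (w * of_real 0) = 0"
    by simp
  thus False using g_0 by simp
qed

text \<open>The differential form of the Sturm-Liouville orthogonality relation: the boundary term \<open>Q * cnj P\<close>
  has a derivative that involves only squared moduli.\<close>

lemma QP_has_derivative:
  assumes s: "s > 0"
  shows "((\<lambda>s. Re (\<alpha> * (Q w s * cnj (P w s)))) has_real_derivative
           Re (\<alpha> * ((of_real (\<nu>\<^sup>2) - w * of_real s) * of_real ((norm (P w s))\<^sup>2) +
                     of_real ((norm (Q w s))\<^sup>2))) / (2 * s)) (at s)"
proof -
  have "((\<lambda>s. \<alpha> * (Q w s * cnj (P w s))) has_vector_derivative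
           \<alpha> * ((of_real (\<nu>\<^sup>2) - w * of_real s) * of_real ((norm (P w s))\<^sup>2) +
                     of_real ((norm (Q w s))\<^sup>2)) / of_real (2 * s)) (at s)"
    by (rule has_vector_derivative_eq_rhs[OF has_vector_derivative_mult_right[OF
          has_vector_derivative_mult[OF Q_has_derivative[OF s]
            has_vector_derivative_cnj[OF P_has_derivative[OF s]]]]])
       (use s in \<open>simp add: complex_norm_square divide_simps ring_distribs mult_ac del: of_real_power\<close>)
  from bounded_linear.has_vector_derivative[OF bounded_linear_Re this]
  show ?thesis
    unfolding has_real_derivative_iff_has_vector_derivative Re_divide_of_real .
qed

text \<open>The differential form of the norm integral of a Bessel function (Lommel): all cross terms cancel,
  and for positive \<open>r\<close> the energy is increasing.\<close>

lemma energy_has_derivative: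
  assumes s: "s > 0"
  shows "((\<lambda>s. Re (Q (of_real r) s * cnj (Q (of_real r) s) +
                 of_real (r * s - \<nu>\<^sup>2) * (P (of_real r) s * cnj (P (of_real r) s))))
           has_real_derivative r * (norm (P (of_real r) s))\<^sup>2) (at s)"
proof -
  have lin: "((\<lambda>s. complex_of_real (r * s - \<nu>\<^sup>2)) has_vector_derivative of_real r) (at s)"
    by (auto intro!: has_vector_derivative_of_real derivative_eq_intros)
  note dP = P_has_derivative[OF s, of "of_real r"] and dQ = Q_has_derivative[OF s, of "of_real r"]
  have "((\<lambda>s. Q (of_real r) s * cnj (Q (of_real r) s) +
            of_real (r * s - \<nu>\<^sup>2) * (P (of_real r) s * cnj (P (of_real r) s)))
          has_vector_derivative of_real (r * (norm (P (of_real r) s))\<^sup>2)) (at s)"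
    by (rule has_vector_derivative_eq_rhs[OF has_vector_derivative_add[OF
          has_vector_derivative_mult[OF dQ has_vector_derivative_cnj[OF dQ]]
          has_vector_derivative_mult[OF lin
            has_vector_derivative_mult[OF dP has_vector_derivative_cnj[OF dP]]]]])
       (use s in \<open>simp add: complex_norm_square divide_simps ring_distribs mult_ac del: of_real_power\<close>)
  from bounded_linear.has_vector_derivative[OF bounded_linear_Re this]
  show ?thesis
    unfolding has_real_derivative_iff_has_vector_derivative Re_complex_of_real .
qed

text \<open>At a zero of \<open>f\<close> or of \<open>g\<close> the function \<open>Q * cnj P\<close> vanishes at both ends of the unit interval. If \<open>w\<close>
  were not real, its imaginary part would be strictly monotone, and if \<open>w\<close> were real and at most \<open>\<nu>\<^sup>2\<close>,
  its real part would be.\<close>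

lemma zero_imp_real_gt:
  assumes zero: "f w = 0 \<or> g w = 0"
  shows "Im w = 0" and "Re w > \<nu>\<^sup>2"
proof -
  have D0: "Re (\<alpha> * ((of_real (\<nu>\<^sup>2) - w * of_real s) * of_real ((norm (P w s))\<^sup>2) +
                     of_real ((norm (Q w s))\<^sup>2))) / (2 * s) = 0"
    if s: "0 < s" "s < 1"
      and nonneg: "\<And>s. 0 < s \<Longrightarrow> s < 1 \<Longrightarrow> 0 \<le> Re (\<alpha> * ((of_real (\<nu>\<^sup>2) - w * of_real s) * 
            of_real ((norm (P w s))\<^sup>2) + of_real ((norm (Q w s))\<^sup>2))) / (2 * s)"
    for \<alpha> s
  proof (rule equal_ends_imp_derivative_zero[OF _ _ QP_has_derivative nonneg s])
    show "continuous_on {0..1} (\<lambda>s. Re (\<alpha> * (Q w s * cnj (P w s))))"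
      by (intro continuous_intros continuous_on_P continuous_on_Q)
    show "Re (\<alpha> * (Q w 0 * cnj (P w 0))) = Re (\<alpha> * (Q w 1 * cnj (P w 1)))"
      using zero by (auto simp: P_0 P_1 Q_1)
  qed
  obtain s where s: "0 < s" "s < 1" and Ps: "P w s \<noteq> 0"
    using P_nonzero by blast
  \<comment> \<open>The multiplier \<open>\<i> * Im w\<close> extracts the imaginary part with the sign that makes the derivative a square.\<close>
  have eq: "Re (of_real (Im w) * \<i> * ((of_real (\<nu>\<^sup>2) - w * of_real s) * of_real ((norm (P w s))\<^sup>2) +
                     of_real ((norm (Q w s))\<^sup>2))) / (2 * s) = (Im w)\<^sup>2 * (norm (P w s))\<^sup>2 / 2" if "s > 0" for s
    using that by (simp add: power2_eq_square)
  have "(Im w)\<^sup>2 * (norm (P w s))\<^sup>2 / 2 = 0"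
    unfolding eq[OF s(1), symmetric] by (rule D0[OF s]) (simp only: eq, simp)
  thus Im: "Im w = 0" using Ps by simp
  show "Re w > \<nu>\<^sup>2"
  proof (rule ccontr)
    assume le: "\<not> ?thesis"
    have eq: "Re (1 * ((of_real (\<nu>\<^sup>2) - w * of_real s) * of_real ((norm (P w s))\<^sup>2) +
                     of_real ((norm (Q w s))\<^sup>2))) / (2 * s) = 
               ((\<nu>\<^sup>2 - Re w * s) * (norm (P w s))\<^sup>2 + (norm (Q w s))\<^sup>2) / (2 * s)" for s
      using Im by (simp del: of_real_power)
    have less: "Re w * s < \<nu>\<^sup>2" if "0 < s" "s < 1" for s
    proof -
      have "Re w * s \<le> \<nu>\<^sup>2 * s" using le that by (intro mult_right_mono) auto
      also have "\<dots> < \<nu>\<^sup>2 * 1" using that \<nu> by (intro mult_strict_left_mono) auto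
      finally show ?thesis by simp
    qed
    have "((\<nu>\<^sup>2 - Re w * s) * (norm (P w s))\<^sup>2 + (norm (Q w s))\<^sup>2) / (2 * s) = 0"
      using D0[OF s, of 1] less unfolding eq by (simp add: less_imp_le)
    moreover have "(\<nu>\<^sup>2 - Re w * s) * (norm (P w s))\<^sup>2 > 0"
      using less[OF s] Ps by simp
    ultimately show False
      using s zero_le_power2[of "norm (Q w s)"] by (simp add: divide_eq_0_iff) 
  qed
qed

text \<open>At a common zero the energy would vanish at both ends although it is increasing.\<close>

lemma no_common_zero:
  assumes "f w = 0" shows "g w \<noteq> 0"
proof
  assume g: "g w = 0"
  define r where "r = Re w"
  have w: "w = of_real r" and r: "r > \<nu>\<^sup>2"
    using zero_imp_real_gt[of w] assms by (simp_all add: complex_eq_iff r_def)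
  have r0: "r > 0" using r \<nu> by (meson less_trans zero_less_power)
  obtain s where s: "0 < s" "s < 1" and Ps: "P w s \<noteq> 0"
    using P_nonzero by blast
  have "r * (norm (P (of_real r) s))\<^sup>2 = 0"
  proof (rule equal_ends_imp_derivative_zero[OF _ _ energy_has_derivative _ s])
    show "continuous_on {0..1} (\<lambda>s. Re (Q (of_real r) s * cnj (Q (of_real r) s) +
                 of_real (r * s - \<nu>\<^sup>2) * (P (of_real r) s * cnj (P (of_real r) s))))"
      by (intro continuous_intros continuous_on_P continuous_on_Q)
  qed (use assms g r0 in \<open>simp_all add: P_0 Q_0 P_1 Q_1 flip: w\<close>)
  thus False using Ps r0 by (simp add: w)
qed

text \<open>At a zero of \<open>f\<close> the system gives \<open>2 w f' = (\<nu>\<^sup>2 - w) g\<close>, and neither factor on the right vanishes.\<close>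

sublocale simple_zeros_minimal_type f
proof
  show "deriv f w \<noteq> 0" if w: "f w = 0" for w
  proof
    assume "deriv f w = 0"
    hence "(of_real (\<nu>\<^sup>2) - w) * g w = 0"
      using ode_f[of w] w by simp
    moreover have "w \<noteq> of_real (\<nu>\<^sup>2)"
      using zero_imp_real_gt(2)[of w] w by auto
    ultimately show False using no_common_zero[OF w] by simp
  qed
qed (use holf f_type f_0 in auto)

end

section \<open>Enumeration of the zeros\<close>

lemma strict_mono_enumeration:
  fixes A :: "real set"
  assumes inf: "infinite A" and fin: "\<And>R. finite {x \<in> A. x \<le> R}"
  obtains t :: "nat \<Rightarrow> real" where "strict_mono t" "range t = A" "filterlim t at_top sequentially"
proof -
  have least: "\<exists>x. P x \<and> x \<in> A \<and> (\<forall>y\<in>A. P y \<longrightarrow> x \<le> y)" if "P x" "x \<in> A" for P x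
  proof -
    let ?S = "{y \<in> A. y \<le> x \<and> P y}"
    have S: "finite ?S" "x \<in> ?S"
      using that by (auto intro: finite_subset[OF _ fin[of x]])
    hence "Min ?S \<in> ?S" using Min_in by blast
    moreover have "Min ?S \<le> y" if "y \<in> A" "P y" for y
    proof (cases "y \<le> x")
      case True
      thus ?thesis using that by (intro Min_le S) auto
    next
      case False
      thus ?thesis using Min_le[OF S] by linarith
    qed
    ultimately show ?thesis by blast
  qed
  have greater: "\<exists>y\<in>A. x < y" for x
  proof (rule ccontr)
    assume "\<not> ?thesis"
    hence "A = {y \<in> A. y \<le> x}" by force
    thus False using inf fin[of x] by simp
  qed
  obtain t :: "nat \<Rightarrow> real" where t0: "t 0 \<in> A" "\<And>y. y \<in> A \<Longrightarrow> t 0 \<le> y"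
    and tS: "\<And>n. t n < t (Suc n) \<and> (\<forall>y\<in>A. t n < y \<longrightarrow> t (Suc n) \<le> y)"
    and tA: "\<And>n. t n \<in> A"
  proof -
    have "\<exists>t. \<forall>n. (t n \<in> A \<and> (n = 0 \<longrightarrow> (\<forall>y\<in>A. t n \<le> y))) \<and>
            (t n < t (Suc n) \<and> (\<forall>y\<in>A. t n < y \<longrightarrow> t (Suc n) \<le> y))"
    proof (rule dependent_nat_choice)
      show "\<exists>x. x \<in> A \<and> (0 = 0 \<longrightarrow> (\<forall>y\<in>A. x \<le> y))"
        using inf least[of "\<lambda>_. True"] by (metis finite.emptyI ex_in_conv)
      show "\<exists>y. (y \<in> A \<and> (Suc n = 0 \<longrightarrow> (\<forall>z\<in>A. y \<le> z))) \<and> x < y \<and> (\<forall>z\<in>A. x < z \<longrightarrow> y \<le> z)" for x n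
        using greater[of x] least[of "\<lambda>y. x < y"] by blast
    qed
    thus ?thesis using that by blast
  qed
  have mono: "strict_mono t"
    using tS by (simp add: strict_mono_Suc_iff)
  have unbounded: "\<exists>n. R < t n" for R
  proof (rule ccontr)
    assume "\<not> ?thesis"
    hence "range t \<subseteq> {x \<in> A. x \<le> R}" using tA by (auto simp: not_less)
    hence "finite (range t)" using fin finite_subset by blast
    thus False using mono by (simp add: finite_image_iff strict_mono_imp_inj_on)
  qed
  have "range t = A"
  proof
    show "A \<subseteq> range t"
    proof
      fix y assume y: "y \<in> A"
      show "y \<in> range t"
      proof (rule ccontr)
        assume ny: "y \<notin> range t"
        have "t n < y" for n
        proof (induction n)
          case 0
          show ?case using t0(2)[OF y] ny by (metis order_less_le rangeI)
        next
          case (Suc n)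
          thus ?case using tS[of n] y ny by (metis order_less_le rangeI)
        qed
        thus False using unbounded[of y] by (meson not_less_iff_gr_or_eq)
      qed
    qed
  qed (use tA in auto)
  moreover have "filterlim t at_top sequentially"
    unfolding filterlim_at_top_gt[of _ _ 0] eventually_sequentially
  proof (intro allI impI)
    fix R :: real
    obtain n where "R < t n" using unbounded by blast
    thus "\<exists>n. \<forall>m\<ge>n. R \<le> t m"
      using mono by (meson less_imp_le order_trans strict_mono_less_eq)
  qed
  ultimately show ?thesis using mono that by blast
qed

text \<open>Zeros are enumerated in the squared variable, where the functions are entire.\<close>

lemma nth_pos_zero_eq_sqrt:
  assumes mono: "strict_mono t" and range: "range t = {s. s > 0 \<and> P s}"
    and zero_iff: "\<And>x. x > 0 \<Longrightarrow> \<phi> x = 0 \<longleftrightarrow> P (x\<^sup>2)"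
  shows "nth_pos_zero \<phi> (Suc k) = sqrt (t k)"
proof -
  have t: "t k > 0 \<and> P (t k)" for k
    using range by (metis (mono_tags, lifting) mem_Collect_eq rangeI)
  have "nth_pos_zero \<phi> (Suc k) = sqrt (t (Suc k - 1))"
  proof (rule nth_pos_zero_eq_enumeration)
    show "strict_mono_on {1..} (\<lambda>n. sqrt (t (n - 1)))"
      using mono by (auto intro!: strict_mono_onI simp: strict_mono_less)
    show "(\<lambda>n. sqrt (t (n - 1))) ` {1..} = {x. x > 0 \<and> \<phi> x = 0}"
    proof (intro equalityI subsetI)
      fix x assume "x \<in> {x. x > 0 \<and> \<phi> x = 0}"
      hence x: "x > 0" "x\<^sup>2 \<in> range t"
        unfolding range using zero_iff by auto
      then obtain k where "x\<^sup>2 = t k" by auto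
      hence "x = sqrt (t (Suc k - 1))"
        using x by (simp add: real_sqrt_unique)
      thus "x \<in> (\<lambda>n. sqrt (t (n - 1))) ` {1..}" by (intro image_eqI[of _ _ "Suc k"]) auto
    qed (use t zero_iff in \<open>auto simp: less_imp_le\<close>)
  qed simp
  thus ?thesis by simp
qed

context bessel
begin

text \<open>With \<open>n\<close> zeros, \<open>f\<close> would be a polynomial of degree \<open>n\<close>. On the negative axis all terms of the series
  have the same sign, so the term of degree \<open>n + 1\<close> alone exceeds this growth.\<close>

lemma infinite_zeros: "infinite {w. f w = 0}"
proof
  assume fin: "finite {w. f w = 0}"
  define n where "n = card {w. f w = 0}"
  define K where "K = norm (f 0) * (1 + 1 / \<nu>\<^sup>2) ^ n"
  define b where "b = (2 * real (Suc n) + \<nu>) * \<bar>c (Suc n)\<bar>"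
  have b: "b > 0"
    using \<nu> coeff_nonzero[of "Suc n"] by (simp add: b_def)
  have upper: "norm (f (- of_real y)) \<le> K * y ^ n" if y: "y \<ge> 1" for y
  proof -
    have "norm (\<Prod>w | f w = 0. 1 - (- of_real y) / w) \<le> (\<Prod>w | f w = 0. (1 + 1 / \<nu>\<^sup>2) * y)"
      unfolding prod_norm[symmetric]
    proof (intro prod_mono conjI norm_ge_zero)
      fix w assume "w \<in> {w. f w = 0}"
      hence w: "Re w > \<nu>\<^sup>2" using zero_imp_real_gt[of w] by simp
      hence nw: "norm w \<ge> \<nu>\<^sup>2" using complex_Re_le_cmod[of w] by simp
      have \<nu>2: "\<nu>\<^sup>2 > 0" using \<nu> by simp
      have "norm (1 - (- of_real y) / w) \<le> 1 + y / norm w"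
        using norm_triangle_ineq[of 1 "of_real y / w"] y by (simp add: norm_divide)
      also have "\<dots> \<le> y + y / \<nu>\<^sup>2"
        using y nw \<nu>2 less_le_trans[OF \<nu>2 nw] 
        by (intro add_mono divide_left_mono mult_pos_pos) auto
      finally show "norm (1 - (- of_real y) / w) \<le> (1 + 1 / \<nu>\<^sup>2) * y"
        by (simp add: algebra_simps)
    qed
    also have "\<dots> = ((1 + 1 / \<nu>\<^sup>2) * y) ^ n" by (simp add: n_def)
    finally have "norm (f 0) * norm (\<Prod>w | f w = 0. 1 - (- of_real y) / w)
                    \<le> norm (f 0) * ((1 + 1 / \<nu>\<^sup>2) * y) ^ n"
      by (rule mult_left_mono) simp
    thus ?thesis
      unfolding finitely_many_zeros_imp_product[OF fin, of "- of_real y"] K_def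
      by (simp add: norm_mult power_mult_distrib mult_ac)
  qed
  have lower: "b * y ^ Suc n \<le> norm (f (- of_real y))" if y: "y \<ge> 1" for y
  proof -
    have term_eq: "Re (of_real ((2 * real m + \<nu>) * c m) * (- of_real y) ^ m) = (2 * real m + \<nu>) * \<bar>c m\<bar> * y ^ m" for m
    proof -
      have "\<bar>c m\<bar> = (-1) ^ m * c m"
      proof -
        have "Gamma (real m + \<nu> + 1) > 0"
          using \<nu> by (intro Gamma_real_pos) auto
        thus ?thesis by (simp add: bessel_coeff_def abs_mult power_mult_distrib[symmetric])
      qed
      moreover have "of_real ((2 * real m + \<nu>) * c m) * (- of_real y) ^ m = 
              complex_of_real ((2 * real m + \<nu>) * c m * (- y) ^ m)"
        by (simp only: of_real_mult of_real_power of_real_minus)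
      moreover have "(- y) ^ m = (-1) ^ m * y ^ m"
        by (rule power_minus)
      ultimately show ?thesis by (simp only: Re_complex_of_real) (simp only: mult_ac)
    qed
    have sums: "(\<lambda>m. (2 * real m + \<nu>) * \<bar>c m\<bar> * y ^ m) sums Re (f (- of_real y))"
      using sums_Re[OF f_sums[of "- of_real y"]] unfolding term_eq .
    have "b * y ^ Suc n \<le> Re (f (- of_real y))"
      using sum_le_suminf[OF sums_summable[OF sums], of "{Suc n}"] \<nu> y
      unfolding sums_unique[OF sums, symmetric] by (simp add: b_def)
    thus ?thesis using complex_Re_le_cmod order_trans by blast
  qed
  define y where "y = max 1 (K / b + 1)"
  have y: "y \<ge> 1" "y > K / b" by (auto simp: y_def)
  have "b * y ^ Suc n \<le> K * y ^ n"
    using upper[OF y(1)] lower[OF y(1)] by simp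
  hence "b * y \<le> K"
    using y(1) by simp
  thus False using y(2) b by (simp add: field_simps)
qed

lemma positive_zeros_f: "{w. f w = 0} = of_real ` {s. s > 0 \<and> f (of_real s) = 0}"
proof (intro equalityI subsetI)
  fix w assume "w \<in> {w. f w = 0}"
  hence "f w = 0" "Im w = 0" "Re w > \<nu>\<^sup>2" using zero_imp_real_gt[of w] by auto
  moreover from this have "w = of_real (Re w)" by (simp add: complex_eq_iff)
  moreover have "Re w > 0" using \<open>Re w > \<nu>\<^sup>2\<close> by (meson le_less_trans zero_le_power2)
  ultimately show "w \<in> of_real ` {s. s > 0 \<and> f (of_real s) = 0}"
    by (intro image_eqI[of _ _ "Re w"]) auto
qed auto

lemma f_zeros_enumeration:
  obtains t :: "nat \<Rightarrow> real" where "strict_mono t" "range t = {s. s > 0 \<and> f (of_real s) = 0}"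
    "filterlim t at_top sequentially"
proof (rule strict_mono_enumeration)
  show "infinite {s. s > 0 \<and> f (of_real s) = 0}"
    using infinite_zeros unfolding positive_zeros_f by blast
  show "finite {x \<in> {s. s > 0 \<and> f (of_real s) = 0}. x \<le> R}" for R
  proof (rule finite_imageD)
    show "finite (complex_of_real ` {x \<in> {s. s > 0 \<and> f (of_real s) = 0}. x \<le> R})"
      by (rule finite_subset[OF _ finite_zeros_upto[of R]]) (auto simp: zeros_upto_def)
  qed (auto intro: inj_onI)
qed (use that in blast)

text \<open>Between consecutive zeros of \<open>f\<close>, Rolle's theorem for \<open>s powr (\<nu> / 2) * f s\<close> yields a zero of
  \<open>(\<nu>\<^sup>2 - s) * g s\<close>, and \<open>s > \<nu>\<^sup>2\<close> there. So the infinitude of the zeros of \<open>g\<close> follows from that for \<open>f\<close>.\<close>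

lemma g_zeros_enumeration:
  obtains t :: "nat \<Rightarrow> real" where "strict_mono t" "range t = {s. s > 0 \<and> g (of_real s) = 0}"
proof (rule strict_mono_enumeration)
  let ?Z = "{s. s > 0 \<and> g (of_real s) = 0}"
  obtain t :: "nat \<Rightarrow> real" where t: "strict_mono t" "range t = {s. s > 0 \<and> f (of_real s) = 0}"
    "filterlim t at_top sequentially"
    by (rule f_zeros_enumeration)
  have tk: "f (of_real (t k)) = 0" "t k > 0" for k
    using t(2) by blast+
  have between: "\<exists>x. t k < x \<and> x < t (Suc k) \<and> x \<in> ?Z" for k
  proof -
    have less: "t k < t (Suc k)" using t(1) by (simp add: strict_mono_less)
    have D: "((\<lambda>s. Re (Q 1 s)) has_real_derivative (\<nu>\<^sup>2 - s) * Re (P 1 s) / (2 * s)) (at s)" if "s > 0" for s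
    proof -
      from bounded_linear.has_vector_derivative[OF bounded_linear_Re Q_has_derivative[OF that, of 1]]
      have "((\<lambda>s. Re (Q 1 s)) has_real_derivative 
               Re ((of_real (\<nu>\<^sup>2) - 1 * of_real s) * P 1 s / of_real (2 * s))) (at s)"
        unfolding has_real_derivative_iff_has_vector_derivative .
      moreover have "(of_real (\<nu>\<^sup>2) - 1 * of_real s) * P 1 s / of_real (2 * s) = 
                       of_real ((\<nu>\<^sup>2 - s) / (2 * s)) * P 1 s" by simp
      moreover have "Re (of_real a * z) = a * Re z" for a z
        by simp
      ultimately show ?thesis by (simp only: times_divide_eq_left)
    qed
    have "\<exists>x. t k < x \<and> x < t (Suc k) \<and> ((\<lambda>s. Re (Q 1 s)) has_real_derivative 0) (at x)"
    proof (rule Rolle[OF less])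
      show "Re (Q 1 (t k)) = Re (Q 1 (t (Suc k)))"
        using tk by (simp add: Q_def)
      show "continuous_on {t k..t (Suc k)} (\<lambda>s. Re (Q 1 s))"
      proof (intro continuous_at_imp_continuous_on ballI)
        fix x assume "x \<in> {t k..t (Suc k)}"
        hence "x > 0" using tk(2)[of k] by simp
        thus "isCont (\<lambda>s. Re (Q 1 s)) x" by (rule DERIV_isCont[OF D])
      qed
      show "(\<lambda>s. Re (Q 1 s)) differentiable at x" if "t k < x" "x < t (Suc k)" for x
        using D[of x] tk(2)[of k] that real_differentiable_def by force
    qed
    then obtain x where x: "t k < x" "x < t (Suc k)" "((\<lambda>s. Re (Q 1 s)) has_real_derivative 0) (at x)"
      by blast
    have x0: "x > 0" using x tk(2)[of k] by simp
    have "\<nu>\<^sup>2 < x"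
      using zero_imp_real_gt(2)[of "of_real (t k)"] tk(1)[of k] x(1) by simp
    hence "Re (P 1 x) = 0"
      using DERIV_unique[OF x(3) D[OF x0]] x0 by simp
    hence "Re (g (of_real x)) = 0"
      using x0 by (simp add: P_def)
    hence "g (of_real x) = 0"
      using Im_g[of x] by (simp add: complex_eq_iff)
    thus ?thesis using x x0 by blast
  qed
  show "infinite ?Z"
  proof
    assume "finite ?Z"
    then obtain B where B: "\<And>x. x \<in> ?Z \<Longrightarrow> \<bar>x\<bar> \<le> B"
      using finite_imp_bounded[OF \<open>finite ?Z\<close>] unfolding bounded_iff real_norm_def by blast
    obtain k where "t k \<ge> B"
      using t(3) by (auto simp: filterlim_at_top eventually_sequentially)
    thus False using between[of k] B by force
  qed
  show "finite {x \<in> ?Z. x \<le> R}" for R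
  proof (rule finite_imageD)
    show "finite (complex_of_real ` {x \<in> ?Z. x \<le> R})"
    proof (rule finite_subset)
      obtain x where "g x = 0" using between[of 0] by blast
      hence "\<not> g constant_on UNIV" using g_0 unfolding constant_on_def by (metis UNIV_I)
      thus "finite {z \<in> cball 0 R. g z = 0}"
        using holomorphic_compact_finite_zeros[OF holg, of "cball 0 R"] by auto
    qed auto
  qed (auto intro: inj_onI)
qed (use that in blast)

end

section \<open>The sum over the zeros\<close>

context bessel
begin

lemma sums_over_zeros:
  assumes t: "strict_mono t" "range t = {s. s > 0 \<and> f (of_real s) = 0}" "filterlim t at_top sequentially"
    and lim: "((\<lambda>R. \<Sum>w\<in>zeros_upto R. \<phi> w) \<longlongrightarrow> l) at_top"
  shows "(\<lambda>k. \<phi> (of_real (t k))) sums l"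
proof -
  have "zeros_upto (t n) = (\<lambda>k. of_real (t k)) ` {..n}" for n
  proof -
    have "zeros_upto (t n) = {w \<in> of_real ` range t. norm w \<le> t n}"
      unfolding zeros_upto_def t(2) positive_zeros_f[symmetric] by auto
    also have "\<dots> = (\<lambda>k. of_real (t k)) ` {k. \<bar>t k\<bar> \<le> t n}"
      by auto
    also have "{k. \<bar>t k\<bar> \<le> t n} = {..n}"
    proof -
      have "t k > 0" for k using t(2) by blast
      thus ?thesis using t(1) by (auto simp: strict_mono_less_eq less_imp_le abs_of_pos)
    qed
    finally show ?thesis .
  qed
  moreover have "inj_on (\<lambda>k. complex_of_real (t k)) A" for A
    using strict_mono_imp_inj_on[OF t(1)] by (auto simp: inj_on_def)
  ultimately have "(\<Sum>w\<in>zeros_upto (t n). \<phi> w) = (\<Sum>k\<le>n. \<phi> (of_real (t k)))" for n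
    by (simp add: sum.reindex)
  thus ?thesis
    unfolding sums_def_le using filterlim_compose[OF lim t(3)] by simp
qed

text \<open>Away from zeros the system gives \<open>f' / f = - \<nu> / (2 z) + (\<nu>\<^sup>2 - z) / (2 z) * g / f\<close>. At a zero of \<open>g\<close> only
  the derivative of \<open>g\<close> survives in the last summand, and there \<open>f = 2 z g'\<close>.\<close>

lemma log_deriv_at_g_zero:
  assumes g: "g a = 0"
  shows "deriv f a / f a = - of_real \<nu> / (2 * a)"
    and "deriv (\<lambda>z. deriv f z / f z) a = of_real \<nu> / (2 * a\<^sup>2) + (of_real (\<nu>\<^sup>2) - a) / (4 * a\<^sup>2)"
proof -
  have fa: "f a \<noteq> 0" and a: "a \<noteq> 0"
    using no_common_zero g g_0 by auto
  have L: "deriv f z / f z = - of_real \<nu> / (2 * z) + g z * ((of_real (\<nu>\<^sup>2) - z) / (2 * z * f z))"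
    if "z \<noteq> 0" "f z \<noteq> 0" for z
    using ode_f[of z] that by (simp add: divide_simps del: of_real_power) (simp add: algebra_simps)
  show "deriv f a / f a = - of_real \<nu> / (2 * a)"
    using L[OF a fa] g by simp
  have f'g: "f a = 2 * a * deriv g a"
    using ode_g[of a] g by simp
  have Df: "(f has_field_derivative deriv f a) (at a)" and Dg: "(g has_field_derivative deriv g a) (at a)"
    using holf holg by (auto intro: holomorphic_derivI)
  \<comment> \<open>The derivative of \<open>?q\<close> is not computed, since it gets multiplied by \<open>g a = 0\<close>.\<close>
  let ?q = "\<lambda>z. (of_real (\<nu>\<^sup>2) - z) / (2 * z * f z)"
  have "\<exists>D. (?q has_field_derivative D) (at a)"
    using Df a fa by (intro exI) (auto intro!: derivative_eq_intros)
  then obtain D where D: "(?q has_field_derivative D) (at a)" by blast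
  have 1: "((\<lambda>z. - of_real \<nu> / (2 * z)) has_field_derivative of_real \<nu> / (2 * a\<^sup>2)) (at a)"
    using a by (auto intro!: derivative_eq_intros simp: power2_eq_square)
  have D': "((\<lambda>z. - of_real \<nu> / (2 * z) + g z * ?q z) has_field_derivative
           of_real \<nu> / (2 * a\<^sup>2) + (g a * D + deriv g a * ?q a)) (at a)"
    by (rule DERIV_add[OF 1 DERIV_mult'[OF Dg D]])
  have "open {z. z \<noteq> 0 \<and> f z \<noteq> 0}"
    using holf by (intro open_Collect_conj open_Collect_neq holomorphic_on_imp_continuous_on)
                  (auto intro: continuous_intros)
  hence "\<forall>\<^sub>F z in nhds a. z \<noteq> 0 \<and> f z \<noteq> 0"
    using eventually_nhds_in_open[of "{z. z \<noteq> 0 \<and> f z \<noteq> 0}" a] a fa by simp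
  hence ev: "\<forall>\<^sub>F z in nhds a. deriv f z / f z = - of_real \<nu> / (2 * z) + g z * ?q z"
    by (rule eventually_mono) (use L in blast)
  have "((\<lambda>z. deriv f z / f z) has_field_derivative
           of_real \<nu> / (2 * a\<^sup>2) + (g a * D + deriv g a * ?q a)) (at a)"
    using DERIV_cong_ev[OF refl ev refl] D' by (rule iffD2)
  hence "deriv (\<lambda>z. deriv f z / f z) a = of_real \<nu> / (2 * a\<^sup>2) + (g a * D + deriv g a * ?q a)"
    by (rule DERIV_imp_deriv)
  moreover have "deriv g a * ?q a = (of_real (\<nu>\<^sup>2) - a) / (4 * a\<^sup>2)"
    using fa a unfolding f'g by (simp add: power2_eq_square divide_simps del: of_real_power)
  ultimately show "deriv (\<lambda>z. deriv f z / f z) a = of_real \<nu> / (2 * a\<^sup>2) + (of_real (\<nu>\<^sup>2) - a) / (4 * a\<^sup>2)"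
    using g by simp
qed

text \<open>With \<open>v = \<nu>\<^sup>2\<close>, the summand decomposes into multiples of \<open>1 / (v - t)\<close>, \<open>1 / (a - t)\<close> and \<open>1 / (a - t)\<^sup>2\<close>.
  Summed over the zeros of \<open>f\<close> these are values of \<open>f' / f\<close> at \<open>v\<close> and \<open>a\<close> and of \<open>- (f' / f)'\<close> at \<open>a\<close>, all
  three of which the differential equation determines without knowledge of the zeros: at \<open>v\<close> the factor
  \<open>\<nu>\<^sup>2 - z\<close> vanishes, at \<open>a\<close> the factor \<open>g\<close>.\<close>

lemma sum_over_zeros_at_g_zero:
  assumes t: "strict_mono t" "range t = {s. s > 0 \<and> f (of_real s) = 0}" "filterlim t at_top sequentially"
    and a: "g (of_real a) = 0"
  shows "(\<lambda>k. t k / ((t k - \<nu>\<^sup>2) * (a - t k)\<^sup>2)) sums (1 / (4 * a))"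
proof -
  define v where "v = \<nu>\<^sup>2"
  have v0: "v > 0" using \<nu> by (simp add: v_def)
  have av: "a > v"
    using zero_imp_real_gt(2)[of "of_real a"] a by (simp add: v_def)
  have ft: "f (of_real (t k)) = 0" for k
    using t(2) by blast
  have tv: "t k > v" for k
    using zero_imp_real_gt(2)[of "of_real (t k)"] ft by (simp add: v_def)
  have ta: "t k \<noteq> a" for k
    using no_common_zero[OF ft] a by metis
  have fa: "f (of_real a) \<noteq> 0" using no_common_zero a by blast
  have fv: "f (of_real v) \<noteq> 0" using zero_imp_real_gt(2)[of "of_real v"] by (auto simp: v_def)
  have Lv: "deriv f (of_real v) / f (of_real v) = of_real (- \<nu> / (2 * v))"
  proof -
    have "2 * of_real v * deriv f (of_real v) = - of_real \<nu> * f (of_real v)"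
      using ode_f[of "of_real v"] by (simp add: v_def eq_neg_iff_add_eq_0 add.commute)
    thus ?thesis using fv v0 by (simp add: divide_simps mult_ac)
  qed
  have La: "deriv f (of_real a) / f (of_real a) = of_real (- \<nu> / (2 * a))"
    using log_deriv_at_g_zero(1)[OF a] by simp
  have La': "deriv (\<lambda>z. deriv f z / f z) (of_real a) = of_real (\<nu> / (2 * a\<^sup>2) + (v - a) / (4 * a\<^sup>2))"
    using log_deriv_at_g_zero(2)[OF a] by (simp add: v_def)
  have "(\<lambda>k. complex_of_real (1 / (v - t k))) sums of_real (- \<nu> / (2 * v))"
    using sums_over_zeros[OF t log_deriv_limits(1)[OF fv]] unfolding Lv by simp
  hence Sv: "(\<lambda>k. 1 / (v - t k)) sums (- \<nu> / (2 * v))"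
    by (simp only: sums_of_real_iff)
  have "(\<lambda>k. complex_of_real (1 / (a - t k))) sums of_real (- \<nu> / (2 * a))"
    using sums_over_zeros[OF t log_deriv_limits(1)[OF fa]] unfolding La by simp
  hence Sa: "(\<lambda>k. 1 / (a - t k)) sums (- \<nu> / (2 * a))"
    by (simp only: sums_of_real_iff)
  have "(\<lambda>k. complex_of_real (1 / (a - t k)\<^sup>2)) sums of_real (- (\<nu> / (2 * a\<^sup>2) + (v - a) / (4 * a\<^sup>2)))"
    using sums_over_zeros[OF t log_deriv_limits(2)[OF fa]] unfolding La' by simp
  hence Sa': "(\<lambda>k. 1 / (a - t k)\<^sup>2) sums - (\<nu> / (2 * a\<^sup>2) + (v - a) / (4 * a\<^sup>2))"
    by (simp only: sums_of_real_iff)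
  have pf: "a / (a - v) * (1 / (a - t k)\<^sup>2) + v / (a - v)\<^sup>2 * (1 / (a - t k)) - v / (a - v)\<^sup>2 * (1 / (v - t k))
          = t k / ((t k - v) * (a - t k)\<^sup>2)" for k
  proof -
    define p q where "p = a - t k" and "q = t k - v"
    have nz: "p \<noteq> 0" "q \<noteq> 0" "p + q \<noteq> 0"
      using ta[of k] tv[of k] av by (auto simp: p_def q_def)
    have eqs: "a = v + p + q" "t k = v + q"
      by (simp_all add: p_def q_def)
    show ?thesis
      using nz unfolding eqs by (simp add: divide_simps) (simp add: algebra_simps power2_eq_square power3_eq_cube)
  qed
  have val: "a / (a - v) * (- (\<nu> / (2 * a\<^sup>2) + (v - a) / (4 * a\<^sup>2))) + v / (a - v)\<^sup>2 * (- \<nu> / (2 * a))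
               - v / (a - v)\<^sup>2 * (- \<nu> / (2 * v)) = 1 / (4 * a)"
    using av v0 by (simp add: divide_simps) (simp add: algebra_simps power2_eq_square power3_eq_cube)
  show ?thesis
    using sums_diff[OF sums_add[OF sums_mult[OF Sa', of "a / (a - v)"] sums_mult[OF Sa, of "v / (a - v)\<^sup>2"]]
            sums_mult[OF Sv, of "v / (a - v)\<^sup>2"]]
    unfolding pf val v_def[symmetric] .
qed

end

theorem mainTheorem8:
  fixes \<nu> :: real and n :: nat
  assumes "\<nu> > 0" and "n \<ge> 1"
  shows "(\<lambda>k. (bessel_deriv_zero \<nu> (Suc k))\<^sup>2 /
            (((bessel_deriv_zero \<nu> (Suc k))\<^sup>2 - \<nu>\<^sup>2) *
             ((bessel_zero \<nu> n)\<^sup>2 - (bessel_deriv_zero \<nu> (Suc k))\<^sup>2)\<^sup>2))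
         sums (1 / (4 * (bessel_zero \<nu> n)\<^sup>2))"
proof -
  interpret bessel \<nu> by standard (rule assms)
  obtain t :: "nat \<Rightarrow> real" where t: "strict_mono t" "range t = {s. s > 0 \<and> f (of_real s) = 0}"
    "filterlim t at_top sequentially"
    by (rule f_zeros_enumeration)
  obtain r :: "nat \<Rightarrow> real" where r: "strict_mono r" "range r = {s. s > 0 \<and> g (of_real s) = 0}"
    by (rule g_zeros_enumeration)
  have "bessel_deriv_zero \<nu> (Suc k) = sqrt (t k)" for k
    unfolding bessel_deriv_zero_def by (rule nth_pos_zero_eq_sqrt[OF t(1,2) deriv_bessel_J_eq_0_iff])
  moreover have "t k > 0" for k using t(2) by blast
  ultimately have t_eq: "(bessel_deriv_zero \<nu> (Suc k))\<^sup>2 = t k" for k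
    by (simp add: less_imp_le)
  have "bessel_zero \<nu> n = sqrt (r (n - 1))"
    unfolding bessel_zero_def
    using nth_pos_zero_eq_sqrt[OF r bessel_J_eq_0_iff, of "n - 1"] assms(2) by simp
  moreover have rn: "r (n - 1) > 0" "g (of_real (r (n - 1))) = 0" using r(2) by blast+
  ultimately have r_eq: "(bessel_zero \<nu> n)\<^sup>2 = r (n - 1)"
    by simp
  show ?thesis
    unfolding t_eq r_eq by (rule sum_over_zeros_at_g_zero[OF t rn(2)])
qed

end
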